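(* Let $\{\xi_n\}$, for $n\in\mathbb{N}$, $n\ge \ell^{1/c_1}$, be a sequence of isotropic random vectors such that for each $n$, $\xi_n$ is $\mathbb{R}^n$-valued and has a log-concave density with respect to Lebesgue measure on $\mathbb{R}^n$. Consider an ensemble of static team problems with parameters $Q,W,\{R_n\},\{\xi_n\}$, where each $R_n\in\mathbb{R}^{n\times\ell}$ is chosen uniformly and independently from $V_{n,\ell}$ and independently of $\{\xi_k\}$. Let $\gamma_n^*$ be a solution of the $n$-th problem in this ensemble. Suppose the pointwise limit $\hat\gamma:=\lim_{n\to\infty}\gamma_n^*$ exists $\{R_n\}$-almost surely. Then $\hat\gamma=\gamma_G$, $\{R_n\}$-almost surely.
   Context: A random vector $X\in\mathbb{R}^n$ is isotropic if $\mathbb{E}[X]=0$ and its covariance matrix is $I_n$. A density $f$ on $\mathbb{R}^n$ is log-concave if $f=\exp(-G)$ with $G$ convex. $V_{n,\ell}=\{R\in\mathbb{R}^{n\times\ell}: R^\top R=I_\ell\}$ is the Stiefel manifold, with its uniform (rotation-invariant) probability measure. $\varphi_\ell$ is the standard normal density on $\mathbb{R}^\ell$, and $f_Y$ is the density of $Y$. Universal constants. $C,c_1,c_2,c_3,c_4>0$ are fixed universal constants for which the following theorem of Eldan and Klartag holds: if $X$ is an isotropic random vector in $\mathbb{R}^n$ with log-concave density, $1\le \ell\le n^{c_1}$ is an integer, and $R$ is uniformly distributed on $V_{n,\ell}$ and independent of $X$, then with probability (over $R$) at least $1-C\exp(-n^{c_2})$ one has $\left|\frac{f_{R^\top X}(x)}{\varphi_\ell(x)}-1\right|\le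 \frac{C}{n^{c_3}}$ for all $x\in\mathbb{R}^\ell$ with $\|x\|\le n^{c_4}$ (here $f_{R^\top X}$ is the density of $R^\top X$ with $R$ held fixed). Ensemble of static team problems. Fix $m,\ell_1,\dots,\ell_m\in\mathbb{N}$, $\ell=m+\sum_{i=1}^m\ell_i$, a symmetric positive definite $Q\in\mathbb{R}^{m\times m}$, and $W\in\mathbb{R}^{\ell\times\ell}$, partitioned by rows as $W=[W_0;W_1;\dots;W_m]$ with $W_0\in\mathbb{R}^{m\times\ell}$, $W_i\in\mathbb{R}^{\ell_i\times\ell}$. The $n$-th problem has random $R_n$ uniform on $V_{n,\ell}$ (the $R_n$ independent of each other and of all other random variables), matrices $S=W_0R_n^\top$ and $H_i=W_iR_n^\top$ (with each $H_i$ of full row rank), environmental randomness $\xi_n$, and cost $L(u,\xi)=\frac12u^\top Qu+u^\top S\xi+\frac12\xi^\top S^\top Q^{-1}S\xi$. It consists in minimizing, for given $R_n$, $$J(\gamma;\xi_n)=\mathbb{E}\big[L(\gamma^1(H_1\xi_n),\dots,\gamma^m(H_m\xi_n),\xi_n)\big]$$ over all $\gamma=(\gamma^1,\dots,\gamma^m)$ with each $\gamma^i:\mathbb{R}^{\ell_i}\to\mathbb{R}$ measurable; the expectation is over $\xi_n$ only, so $\gamma_n^*$ depends on $R_n$. Gaussian problem. For $\zeta\sim\mathcal{N}(0,I_\ell)$, $J(\gamma;\zeta)$ is the same expression with $\xi_n$ replaced by $\zeta$ and $R_n$ by $I_\ell$, i.e. $S=W_0$, $H_i=W_i$. $\gamma_G$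 is its minimizer over measurable $\gamma$; it is known to be unique and linear. Uniqueness and equality of controllers $\gamma^i:\mathbb{R}^{\ell_i}\to\mathbb{R}$ are understood up to Lebesgue-null sets. "$\{R_n\}$-almost surely" means almost surely with respect to the law of the sequence $\{R_n\}$. *)

theory Defs
  imports "HOL-Probability.Probability" "HOL-Analysis.Embed_Measure"
    "Jordan_Normal_Form.DL_Rank" "Jordan_Normal_Form.Gauss_Jordan_Elimination"
begin

unbundle no vec_syntax
unbundle no inner_syntax

text \<open>Since the dimension \<open>n\<close> varies within the statement, vectors and matrices are those of
  \<open>Jordan_Normal_Form\<close>; their measurable structure is carried over from finite products.\<close>

definition lborel_vec :: "nat \<Rightarrow> real vec measure" where
  "lborel_vec n = embed_measure (\<Pi>\<^sub>M i\<in>{..<n}. lborel) (vec n)"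

definition borel_mat :: "nat \<Rightarrow> nat \<Rightarrow> real mat measure" where
  "borel_mat n k = embed_measure (\<Pi>\<^sub>M ij\<in>{..<n} \<times> {..<k}. borel) (mat n k)"

lemma space_lborel_vec: "space (lborel_vec n) = carrier_vec n"
proof -
  have "v \<in> vec n ` (\<Pi>\<^sub>E i\<in>{..<n}. UNIV)" if "v \<in> carrier_vec n" for v :: "real vec"
  proof
    show "v = vec n (restrict (vec_index v) {..<n})" using that by auto
  qed auto
  then show ?thesis
    by (auto simp: lborel_vec_def space_embed_measure space_PiM)
qed

lemma space_borel_mat: "space (borel_mat n k) = carrier_mat n k"
proof -
  have "A \<in> mat n k ` (\<Pi>\<^sub>E ij\<in>{..<n} \<times> {..<k}. UNIV)" if "A \<in> carrier_mat n k" for A :: "real mat"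
  proof
    show "A = mat n k (restrict (($$) A) ({..<n} \<times> {..<k}))" using that by auto
  qed auto
  then show ?thesis
    by (auto simp: borel_mat_def space_embed_measure space_PiM)
qed

definition vnorm :: "real vec \<Rightarrow> real" where
  "vnorm x = sqrt (x \<bullet> x)"

definition std_normal_vec :: "nat \<Rightarrow> real vec \<Rightarrow> real" where
  "std_normal_vec n x = (\<Prod>i<n. std_normal_density (x $ i))"

definition gauss_vec :: "nat \<Rightarrow> real vec measure" where
  "gauss_vec n = density (lborel_vec n) (\<lambda>x. ennreal (std_normal_vec n x))"


subsection \<open>Isotropic log-concave random vectors\<close>

definition mean_vec :: "nat \<Rightarrow> 'w measure \<Rightarrow> ('w \<Rightarrow> real vec) \<Rightarrow> real vec" where
  "mean_vec n M X = vec n (\<lambda>i. \<integral>\<omega>. X \<omega> $ i \<partial>M)"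

definition cov_mat :: "nat \<Rightarrow> 'w measure \<Rightarrow> ('w \<Rightarrow> real vec) \<Rightarrow> real mat" where
  "cov_mat n M X = mat n n (\<lambda>(i, j).
     \<integral>\<omega>. (X \<omega> $ i - mean_vec n M X $ i) * (X \<omega> $ j - mean_vec n M X $ j) \<partial>M)"

definition isotropic :: "nat \<Rightarrow> 'w measure \<Rightarrow> ('w \<Rightarrow> real vec) \<Rightarrow> bool" where
  "isotropic n M X \<longleftrightarrow>
     X \<in> measurable M (lborel_vec n) \<and>
     (\<forall>i<n. integrable M (\<lambda>\<omega>. (X \<omega> $ i)\<^sup>2)) \<and>
     mean_vec n M X = 0\<^sub>v n \<and> cov_mat n M X = 1\<^sub>m n"

definition exp_uminus :: "ereal \<Rightarrow> real" where
  "exp_uminus a = (if a = \<infinity> then 0 else exp (- real_of_ereal a))"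

text \<open>As usual, the convex function \<open>G\<close> may take the value \<open>\<infinity>\<close>, so that densities vanishing
  outside a convex set (e.g. uniform densities on convex bodies) are included.\<close>

definition log_concave :: "nat \<Rightarrow> (real vec \<Rightarrow> real) \<Rightarrow> bool" where
  "log_concave n f \<longleftrightarrow> (\<exists>G :: real vec \<Rightarrow> ereal.
     (\<forall>x\<in>carrier_vec n. G x \<noteq> - \<infinity> \<and> f x = exp_uminus (G x)) \<and>
     (\<forall>x\<in>carrier_vec n. \<forall>y\<in>carrier_vec n. \<forall>t::real. 0 < t \<and> t < 1 \<longrightarrow>
        G (t \<cdot>\<^sub>v x + (1 - t) \<cdot>\<^sub>v y) \<le> ereal t * G x + ereal (1 - t) * G y))"

definition has_log_concave_density :: "nat \<Rightarrow> 'w measure \<Rightarrow> ('w \<Rightarrow> real vec) \<Rightarrow> bool" where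
  "has_log_concave_density n M X \<longleftrightarrow>
     (\<exists>f. log_concave n f \<and> distributed M (lborel_vec n) X (\<lambda>x. ennreal (f x)))"


subsection \<open>The Stiefel manifold and the Eldan--Klartag theorem\<close>

definition stiefel :: "nat \<Rightarrow> nat \<Rightarrow> real mat set" where
  "stiefel n k = {R \<in> carrier_mat n k. transpose_mat R * R = 1\<^sub>m k}"

text \<open>\<open>stiefel n n\<close> is the orthogonal group, which acts transitively on \<open>stiefel n k\<close>
  from the left.\<close>

definition uniform_stiefel :: "nat \<Rightarrow> nat \<Rightarrow> real mat measure \<Rightarrow> bool" where
  "uniform_stiefel n k \<nu> \<longleftrightarrow>
     prob_space \<nu> \<and> sets \<nu> = sets (borel_mat n k) \<and> (AE R in \<nu>. R \<in> stiefel n k) \<and>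
     (\<forall>U\<in>stiefel n n. distr \<nu> (borel_mat n k) (\<lambda>R. U * R) = \<nu>)"

text \<open>The assertion of the Eldan--Klartag theorem for given constants. It only involves the law
  \<open>\<mu>\<close> of \<open>X\<close> and the law \<open>\<nu>\<close> of \<open>R\<close>: as \<open>R\<close> is independent of \<open>X\<close> and held fixed in
  \<open>f\<^bsub>R\<^sup>T X\<^esub>\<close>, that density is the one of \<open>x \<mapsto> R\<^sup>T x\<close> under \<open>\<mu>\<close>. Densities are
  determined up to null sets only, so the bound is asserted for some version of it; likewise
  the event of large probability is asserted to contain a measurable one.\<close>

definition eldan_klartag :: "real \<Rightarrow> real \<Rightarrow> real \<Rightarrow> real \<Rightarrow> real \<Rightarrow> bool" where
  "eldan_klartag C c1 c2 c3 c4 \<longleftrightarrow> (\<forall>n k \<mu> \<nu>.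
     1 \<le> k \<and> real k \<le> real n powr c1 \<and>
     prob_space \<mu> \<and> sets \<mu> = sets (lborel_vec n) \<and>
     isotropic n \<mu> (\<lambda>x. x) \<and> has_log_concave_density n \<mu> (\<lambda>x. x) \<and> uniform_stiefel n k \<nu> \<longrightarrow>
     (\<exists>E\<in>sets \<nu>. measure \<nu> E \<ge> 1 - C * exp (- (real n powr c2)) \<and>
        (\<forall>R\<in>E. \<exists>f. (\<forall>x. 0 \<le> f x) \<and>
           distributed \<mu> (lborel_vec k) (\<lambda>x. transpose_mat R *\<^sub>v x) (\<lambda>x. ennreal (f x)) \<and>
           (\<forall>x\<in>carrier_vec k. vnorm x \<le> real n powr c4 \<longrightarrow>
              \<bar>f x / std_normal_vec k x - 1\<bar> \<le> C / real n powr c3))))"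


subsection \<open>Static team problems\<close>

definition sym_pos_def :: "nat \<Rightarrow> real mat \<Rightarrow> bool" where
  "sym_pos_def m Q \<longleftrightarrow> Q \<in> carrier_mat m m \<and> transpose_mat Q = Q \<and>
     (\<forall>v\<in>carrier_vec m. v \<noteq> 0\<^sub>v m \<longrightarrow> 0 < v \<bullet> (Q *\<^sub>v v))"

definition full_row_rank :: "real mat \<Rightarrow> bool" where
  "full_row_rank A \<longleftrightarrow> vec_space.rank (dim_row A) A = dim_row A"

definition team_loss :: "real mat \<Rightarrow> real mat \<Rightarrow> real vec \<Rightarrow> real vec \<Rightarrow> real" where
  "team_loss Q S u x =
     1/2 * (u \<bullet> (Q *\<^sub>v u)) + u \<bullet> (S *\<^sub>v x) +
     1/2 * (x \<bullet> ((transpose_mat S * the (mat_inverse Q) * S) *\<^sub>v x))"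

text \<open>A controller profile \<open>\<gamma>\<close> is indexed by \<open>i < dim_row Q\<close>. For symmetric positive definite
  \<open>Q\<close> the loss is \<open>1/2 (u + Q\<^sup>-\<^sup>1 S x)\<^sup>T Q (u + Q\<^sup>-\<^sup>1 S x) \<ge> 0\<close>, so its expectation always exists
  in \<open>[0, \<infinity>]\<close>; the Bochner integral would assign the value \<open>0\<close> to infinite costs.\<close>

definition team_cost ::
  "real mat \<Rightarrow> real mat \<Rightarrow> (nat \<Rightarrow> real mat) \<Rightarrow> 'w measure \<Rightarrow> ('w \<Rightarrow> real vec)
    \<Rightarrow> (nat \<Rightarrow> real vec \<Rightarrow> real) \<Rightarrow> ennreal" where
  "team_cost Q S H M \<xi> \<gamma> =
     (\<integral>\<^sup>+\<omega>. ennreal (team_loss Q S (vec (dim_row Q) (\<lambda>i. \<gamma> i (H i *\<^sub>v \<xi> \<omega>))) (\<xi> \<omega>)) \<partial>M)"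

definition admissible ::
  "real mat \<Rightarrow> (nat \<Rightarrow> real mat) \<Rightarrow> (nat \<Rightarrow> real vec \<Rightarrow> real) \<Rightarrow> bool" where
  "admissible Q H \<gamma> \<longleftrightarrow> (\<forall>i<dim_row Q. \<gamma> i \<in> borel_measurable (lborel_vec (dim_row (H i))))"

definition team_solution ::
  "real mat \<Rightarrow> real mat \<Rightarrow> (nat \<Rightarrow> real mat) \<Rightarrow> 'w measure \<Rightarrow> ('w \<Rightarrow> real vec)
    \<Rightarrow> (nat \<Rightarrow> real vec \<Rightarrow> real) \<Rightarrow> bool" where
  "team_solution Q S H M \<xi> \<gamma> \<longleftrightarrow>
     admissible Q H \<gamma> \<and>
     (\<forall>\<gamma>'. admissible Q H \<gamma>' \<longrightarrow> team_cost Q S H M \<xi> \<gamma> \<le> team_cost Q S H M \<xi> \<gamma>')"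


subsection \<open>The ensemble\<close>

definition row_block :: "real mat \<Rightarrow> nat \<Rightarrow> nat \<Rightarrow> real mat" where
  "row_block W a k = mat k (dim_col W) (\<lambda>(i, j). W $$ (a + i, j))"

text \<open>\<open>obs_block W m ls i\<close> is \<open>W\<^bsub>i+1\<^esub>\<close> in \<open>W = [W\<^sub>0; W\<^sub>1; \<dots>; W\<^sub>m]\<close>: agents are
  numbered from \<open>0\<close>, and \<open>ls i\<close> is the observation dimension of agent \<open>i\<close>.\<close>

definition state_block :: "real mat \<Rightarrow> nat \<Rightarrow> real mat" where
  "state_block W m = row_block W 0 m"

definition obs_block :: "real mat \<Rightarrow> nat \<Rightarrow> (nat \<Rightarrow> nat) \<Rightarrow> nat \<Rightarrow> real mat" where
  "obs_block W m ls i = row_block W (m + (\<Sum>k<i. ls k)) (ls i)"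

definition ens_S :: "real mat \<Rightarrow> nat \<Rightarrow> real mat \<Rightarrow> real mat" where
  "ens_S W m R = state_block W m * transpose_mat R"

definition ens_H :: "real mat \<Rightarrow> nat \<Rightarrow> (nat \<Rightarrow> nat) \<Rightarrow> real mat \<Rightarrow> nat \<Rightarrow> real mat" where
  "ens_H W m ls R i = obs_block W m ls i * transpose_mat R"

definition seq_law :: "'w measure \<Rightarrow> nat set \<Rightarrow> nat \<Rightarrow> (nat \<Rightarrow> 'w \<Rightarrow> real mat)
    \<Rightarrow> (nat \<Rightarrow> real mat) measure" where
  "seq_law M I k R = distr M (\<Pi>\<^sub>M n\<in>I. borel_mat n k) (\<lambda>\<omega>. \<lambda>n\<in>I. R n \<omega>)"

end

theory Submission
  imports Defs "HOL-Real_Asymp.Real_Asymp"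
begin

text \<open>Write \<open>y = R\<^sub>n\<^sup>T \<xi>\<^sub>n\<close>. The \<open>n\<close>-th cost depends on \<open>\<xi>\<^sub>n\<close> only through \<open>y\<close>, so for fixed
  projections all problems live on the same space \<open>\<real>\<^sup>l\<close>: they share the loss and the observation maps of
  the Gaussian problem and differ only in the density \<open>f\<^sub>n\<close> of \<open>y\<close> (\<open>team_cost_observed\<close>). The bound of
  Eldan and Klartag fails with probabilities that are summable in \<open>n\<close>, so by Borel--Cantelli it holds
  for all large \<open>n\<close>, almost surely (\<open>seq_law_eventually\<close>); hence \<open>f\<^sub>n \<rightarrow> \<phi>\<close> pointwise. What
  remains, for each such sequence of projections, is a deterministic statement on minimizers
  (\<open>limit_of_minimizers\<close>).

  Pointwise convergence of densities says nothing about the quadratic growth of the loss at infinity.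
  The point is that isotropy fixes the second moments: the integral of \<open>a + b |y|\<^sup>2\<close> is \<open>a + b l\<close> under
  every \<open>f\<^sub>n\<close> and under \<open>\<phi>\<close>. Comparing with such a majorant, a single use of Fatou's lemma shows that
  the Gaussian cost of the limit profile is at most that of any bounded profile (\<open>limit_risk_le\<close>), and
  by truncation at most that of the Gaussian optimum (\<open>risk_truncation_tendsto\<close>). The loss is strictly
  convex in the controls, so the two profiles coincide (\<open>gauss_minimizer_unique\<close>).

  Full row rank of the observation matrices makes the observation maps surjective. By
  \<open>AE_lborel_vec_surj_iff\<close> null sets of observations and of states then correspond to each other,
  which allows passing between controllers, given up to null sets of observations, and integrals over
  the states.\<close>

section \<open>Lebesgue measure on vectors\<close>

lemma inj_on_vec_PiE: "inj_on (vec n) (space (\<Pi>\<^sub>M i\<in>{..<n}. (lborel :: real measure)))"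
proof (rule inj_onI)
  fix f g :: "nat \<Rightarrow> real"
  assume f: "f \<in> space (\<Pi>\<^sub>M i\<in>{..<n}. lborel)" and g: "g \<in> space (\<Pi>\<^sub>M i\<in>{..<n}. lborel)"
    and eq: "vec n f = vec n g"
  have "f i = g i" if "i < n" for i
    using arg_cong[OF eq, of "\<lambda>v. v $ i"] that by simp
  then show "f = g"
    using f g by (intro extensionalityI[of f "{..<n}" g]) (auto simp: space_PiM PiE_def)
qed

lemma measurable_vec_index [measurable]:
  "i < n \<Longrightarrow> (\<lambda>x. x $ i) \<in> borel_measurable (lborel_vec n)"
  unfolding lborel_vec_def
proof (rule measurable_embed_measure1)
  assume i: "i < n"
  have "(\<lambda>f. f i) \<in> borel_measurable (\<Pi>\<^sub>M i\<in>{..<n}. (lborel :: real measure))"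
    using i measurable_component_singleton[of i "{..<n}" "\<lambda>_. lborel :: real measure"] by simp
  then show "(\<lambda>f. vec n f $ i) \<in> borel_measurable (\<Pi>\<^sub>M i\<in>{..<n}. (lborel :: real measure))"
    using i by simp
qed

lemma measurable_vecI:
  assumes carr: "\<And>x. x \<in> space M \<Longrightarrow> f x \<in> carrier_vec n"
    and comp: "\<And>i. i < n \<Longrightarrow> (\<lambda>x. f x $ i) \<in> borel_measurable M"
  shows "f \<in> measurable M (lborel_vec n)"
proof -
  have "(\<lambda>x. \<lambda>i\<in>{..<n}. f x $ i) \<in> measurable M (\<Pi>\<^sub>M i\<in>{..<n}. (lborel :: real measure))"
    using comp by (intro measurable_restrict) auto
  from measurable_compose[OF this measurable_embed_measure2'[OF inj_on_vec_PiE]]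
  have "(\<lambda>x. vec n (\<lambda>i\<in>{..<n}. f x $ i)) \<in> measurable M (lborel_vec n)"
    unfolding lborel_vec_def .
  moreover have "vec n (\<lambda>i\<in>{..<n}. f x $ i) = f x" if "x \<in> space M" for x
    using carr[OF that] by (intro eq_vecI) auto
  ultimately show ?thesis
    by (subst measurable_cong[where g = "\<lambda>x. vec n (\<lambda>i\<in>{..<n}. f x $ i)"]) auto
qed

lemma mult_mat_vec_index_sum:
  assumes "A \<in> carrier_mat k n" "x \<in> carrier_vec n" "i < k"
  shows "(A *\<^sub>v x) $ i = (\<Sum>j<n. A $$ (i, j) * x $ j)"
  using assms by (auto simp: scalar_prod_def intro!: sum.cong)

lemma measurable_mult_mat_vec:
  assumes A: "A \<in> carrier_mat k n"
  shows "(\<lambda>x. A *\<^sub>v x) \<in> measurable (lborel_vec n) (lborel_vec k)"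
proof (rule measurable_vecI)
  fix i assume "i < k"
  have "(\<lambda>x. (\<Sum>j<n. A $$ (i, j) * x $ j)) \<in> borel_measurable (lborel_vec n)"
    by (intro borel_measurable_sum borel_measurable_times) (auto intro: measurable_vec_index)
  then show "(\<lambda>x. (A *\<^sub>v x) $ i) \<in> borel_measurable (lborel_vec n)"
    by (subst measurable_cong[where g = "\<lambda>x. \<Sum>j<n. A $$ (i, j) * x $ j"])
       (use mult_mat_vec_index_sum[OF A _ \<open>i < k\<close>] in \<open>auto simp: space_lborel_vec\<close>)
qed (use A in \<open>auto simp: space_lborel_vec\<close>)

interpretation lborel_prod: product_sigma_finite "\<lambda>i :: nat. lborel :: real measure"
  by standard

lemma sigma_finite_PiM_lborel: "sigma_finite_measure (\<Pi>\<^sub>M i\<in>{..<n :: nat}. (lborel :: real measure))"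
  by (rule lborel_prod.sigma_finite) simp

lemma lborel_vec_eq_distr:
  "lborel_vec n = distr (\<Pi>\<^sub>M i\<in>{..<n}. (lborel :: real measure)) (lborel_vec n) (vec n)"
  unfolding lborel_vec_def by (rule embed_measure_eq_distr'[OF inj_on_vec_PiE])

lemma measurable_vec [measurable]:
  "vec n \<in> measurable (\<Pi>\<^sub>M i\<in>{..<n}. (lborel :: real measure)) (lborel_vec n)"
  unfolding lborel_vec_def by (rule measurable_embed_measure2'[OF inj_on_vec_PiE])

lemma PiM_lborel_eq_distr:
  "(\<Pi>\<^sub>M i\<in>{..<n}. (lborel :: real measure)) =
     distr (lborel_vec n) (\<Pi>\<^sub>M i\<in>{..<n}. lborel) (\<lambda>x. \<lambda>i\<in>{..<n}. x $ i)" (is "?P = distr _ _ ?g")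
proof -
  have g: "?g \<in> measurable (lborel_vec n) ?P"
    by (intro measurable_restrict) (auto intro: measurable_vec_index)
  have "distr (lborel_vec n) ?P ?g = distr (distr ?P (lborel_vec n) (vec n)) ?P ?g"
    by (simp flip: lborel_vec_eq_distr)
  also have "\<dots> = distr ?P ?P (?g \<circ> vec n)"
    by (rule distr_distr[OF g measurable_vec])
  also have "\<dots> = distr ?P ?P (\<lambda>f. f)"
    by (rule distr_cong) (auto simp: space_PiM PiE_def extensional_def fun_eq_iff)
  finally show ?thesis
    by (simp add: distr_id)
qed

lemma sigma_finite_lborel_vec: "sigma_finite_measure (lborel_vec n)"
proof (rule sigma_finite_measure_distr)
  show "sigma_finite_measure (distr (lborel_vec n) (\<Pi>\<^sub>M i\<in>{..<n}. lborel) (\<lambda>x. \<lambda>i\<in>{..<n}. x $ i))"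
    using sigma_finite_PiM_lborel by (simp flip: PiM_lborel_eq_distr)
  show "(\<lambda>x. \<lambda>i\<in>{..<n}. x $ i) \<in> measurable (lborel_vec n) (\<Pi>\<^sub>M i\<in>{..<n}. (lborel :: real measure))"
    by (intro measurable_restrict) (auto intro: measurable_vec_index)
qed

lemma PiM_lborel_translate:
  "distr (\<Pi>\<^sub>M i\<in>{..<n :: nat}. lborel) (\<Pi>\<^sub>M i\<in>{..<n}. lborel) (\<lambda>f. \<lambda>i\<in>{..<n}. f i + v i) =
     (\<Pi>\<^sub>M i\<in>{..<n}. (lborel :: real measure))" (is "distr ?P ?P ?t = _")
proof (rule lborel_prod.PiM_eqI)
  fix A :: "nat \<Rightarrow> real set" assume A: "\<And>i. i \<in> {..<n} \<Longrightarrow> A i \<in> sets lborel"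
  have t: "?t \<in> measurable ?P ?P"
    by (intro measurable_restrict) measurable
  have eq: "?t -` Pi\<^sub>E {..<n} A \<inter> space ?P = (\<Pi>\<^sub>E i\<in>{..<n}. ((+) (v i)) -` A i)"
    by (auto simp: space_PiM PiE_def Pi_def add.commute)
  have m: "((+) (v i)) -` A i \<in> sets lborel" if "i < n" for i
    using A[of i] that measurable_sets_borel[of "(+) (v i)" borel "A i"] by simp
  have e: "emeasure lborel (((+) (v i)) -` A i) = emeasure lborel (A i)" if "i < n" for i
  proof -
    have "emeasure (distr lborel borel ((+) (v i))) (A i) = emeasure lborel (((+) (v i)) -` A i)"
      using A[of i] that by (subst emeasure_distr) auto
    then show ?thesis by (simp add: lborel_distr_plus)
  qed
  have "emeasure ?P (\<Pi>\<^sub>E i\<in>{..<n}. ((+) (v i)) -` A i) = (\<Prod>i\<in>{..<n}. emeasure lborel (((+) (v i)) -` A i))"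
    by (rule lborel_prod.emeasure_PiM) (use m in auto)
  also have "\<dots> = (\<Prod>i\<in>{..<n}. emeasure lborel (A i))"
    by (rule prod.cong) (use e in auto)
  finally show "emeasure (distr ?P ?P ?t) (Pi\<^sub>E {..<n} A) = (\<Prod>i\<in>{..<n}. emeasure lborel (A i))"
    using A t by (subst emeasure_distr) (auto simp: eq sets_PiM_I_finite)
qed auto

lemma measurable_vec_add:
  assumes "f \<in> measurable M (lborel_vec n)" "g \<in> measurable M (lborel_vec n)"
  shows "(\<lambda>x. f x + g x) \<in> measurable M (lborel_vec n)"
proof (rule measurable_vecI)
  have c: "f x \<in> carrier_vec n" "g x \<in> carrier_vec n" if "x \<in> space M" for x
    using measurable_space[OF assms(1) that] measurable_space[OF assms(2) that]
    by (auto simp: space_lborel_vec)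
  then show "f x + g x \<in> carrier_vec n" if "x \<in> space M" for x
    using that by auto
  fix i assume i: "i < n"
  have "(\<lambda>x. f x $ i + g x $ i) \<in> borel_measurable M"
    by (intro borel_measurable_add measurable_compose[OF assms(1)] measurable_compose[OF assms(2)]
        measurable_vec_index i)
  then show "(\<lambda>x. (f x + g x) $ i) \<in> borel_measurable M"
    by (rule measurable_cong[THEN iffD1, rotated]) (use i in \<open>simp add: carrier_vecD[OF c(2)]\<close>)
qed

lemma lborel_vec_translate:
  assumes v: "v \<in> carrier_vec n"
  shows "distr (lborel_vec n) (lborel_vec n) (\<lambda>x. x + v) = lborel_vec n"
proof -
  let ?P = "\<Pi>\<^sub>M i\<in>{..<n}. (lborel :: real measure)"
  let ?t = "\<lambda>f. \<lambda>i\<in>{..<n}. f i + v $ i"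
  have t: "?t \<in> measurable ?P ?P"
    by (intro measurable_restrict) measurable
  have add: "(\<lambda>x. x + v) \<in> measurable (lborel_vec n) (lborel_vec n)"
    by (intro measurable_vec_add) (use v in \<open>auto simp: space_lborel_vec\<close>)
  have "distr (lborel_vec n) (lborel_vec n) (\<lambda>x. x + v)
      = distr (distr ?P (lborel_vec n) (vec n)) (lborel_vec n) (\<lambda>x. x + v)"
    by (simp flip: lborel_vec_eq_distr)
  also have "\<dots> = distr ?P (lborel_vec n) (\<lambda>f. vec n f + v)"
    by (simp add: distr_distr[OF add measurable_vec] comp_def)
  also have "\<dots> = distr ?P (lborel_vec n) (vec n \<circ> ?t)"
    using v by (intro distr_cong) auto
  also have "\<dots> = distr (distr ?P ?P ?t) (lborel_vec n) (vec n)"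
    by (rule distr_distr[OF measurable_vec t, symmetric])
  also have "\<dots> = lborel_vec n"
    by (simp add: PiM_lborel_translate flip: lborel_vec_eq_distr)
  finally show ?thesis .
qed

lemma AE_lborel_vec_translate:
  assumes v: "v \<in> carrier_vec n" and P: "{x \<in> space (lborel_vec n). P x} \<in> sets (lborel_vec n)"
  shows "(AE x in lborel_vec n. P (x + v)) \<longleftrightarrow> (AE x in lborel_vec n. P x)"
proof -
  have add: "(\<lambda>x. x + v) \<in> measurable (lborel_vec n) (lborel_vec n)"
    by (intro measurable_vec_add) (use v in \<open>auto simp: space_lborel_vec\<close>)
  show ?thesis
    using AE_distr_iff[OF add P] unfolding lborel_vec_translate[OF v] by blast
qed

lemma nn_integral_lborel_vec_prod:
  assumes f: "\<And>i. i < n \<Longrightarrow> f i \<in> borel_measurable borel"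
  shows "(\<integral>\<^sup>+ x. (\<Prod>i<n. f i (x $ i)) \<partial>lborel_vec n) = (\<Prod>i<n. \<integral>\<^sup>+ t. f i t \<partial>lborel)"
proof -
  let ?P = "\<Pi>\<^sub>M i\<in>{..<n}. (lborel :: real measure)"
  have m: "(\<lambda>x. \<Prod>i<n. f i (x $ i)) \<in> borel_measurable (lborel_vec n)"
    by (intro borel_measurable_prod_ennreal measurable_compose[OF measurable_vec_index f]) auto
  have "(\<integral>\<^sup>+ x. (\<Prod>i<n. f i (x $ i)) \<partial>lborel_vec n) = (\<integral>\<^sup>+ g. (\<Prod>i<n. f i (vec n g $ i)) \<partial>?P)"
    using nn_integral_embed_measure'[OF inj_on_vec_PiE] m unfolding lborel_vec_def by blast
  also have "\<dots> = (\<integral>\<^sup>+ g. (\<Prod>i<n. f i (g i)) \<partial>?P)"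
    by simp
  also have "\<dots> = (\<Prod>i<n. \<integral>\<^sup>+ t. f i t \<partial>lborel)"
    by (rule lborel_prod.product_nn_integral_prod) (auto simp: f)
  finally show ?thesis .
qed

lemma std_normal_vec_pos: "0 < std_normal_vec n x"
  unfolding std_normal_vec_def by (intro prod_pos) (auto simp: normal_density_pos)

lemma borel_measurable_std_normal_vec [measurable]:
  "std_normal_vec n \<in> borel_measurable (lborel_vec n)"
  unfolding std_normal_vec_def
  by (intro borel_measurable_prod measurable_compose[OF measurable_vec_index]) auto

lemma nn_integral_std_normal_moment:
  "(\<integral>\<^sup>+ t. ennreal (std_normal_density t) \<partial>lborel) = 1"
  "(\<integral>\<^sup>+ t. ennreal (std_normal_density t) * ennreal (t\<^sup>2) \<partial>lborel) = 1"
proof -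
  have "(\<integral>\<^sup>+ t. ennreal (std_normal_density t * t ^ (2 * k)) \<partial>lborel) =
      ennreal (fact (2 * k) / (2 ^ k * fact k))" for k
    using std_normal_moment_even[of k]
    by (subst nn_integral_eq_integral) (auto simp: has_bochner_integral_iff)
  from this[of 0] this[of 1]
  show "(\<integral>\<^sup>+ t. ennreal (std_normal_density t) \<partial>lborel) = 1"
    "(\<integral>\<^sup>+ t. ennreal (std_normal_density t) * ennreal (t\<^sup>2) \<partial>lborel) = 1"
    by (simp_all add: ennreal_mult fact_2)
qed

lemma nn_integral_std_normal_vec: "(\<integral>\<^sup>+ x. ennreal (std_normal_vec n x) \<partial>lborel_vec n) = 1"
  using nn_integral_lborel_vec_prod[of n "\<lambda>_ t. ennreal (std_normal_density t)"]
  by (simp add: std_normal_vec_def prod_ennreal nn_integral_std_normal_moment)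

lemma nn_integral_std_normal_vec_square:
  assumes j: "j < n"
  shows "(\<integral>\<^sup>+ x. ennreal (std_normal_vec n x) * ennreal ((x $ j)\<^sup>2) \<partial>lborel_vec n) = 1"
proof -
  have "(\<integral>\<^sup>+ x. ennreal (std_normal_vec n x) * ennreal ((x $ j)\<^sup>2) \<partial>lborel_vec n)
      = (\<integral>\<^sup>+ x. (\<Prod>i<n. ennreal (std_normal_density (x $ i)) *
            (if i = j then ennreal ((x $ i)\<^sup>2) else 1)) \<partial>lborel_vec n)"
    using j by (simp add: prod.distrib std_normal_vec_def prod_ennreal)
  also have "\<dots> = (\<Prod>i<n. \<integral>\<^sup>+ t. ennreal (std_normal_density t) * (if i = j then ennreal (t\<^sup>2) else 1) \<partial>lborel)"
    by (rule nn_integral_lborel_vec_prod) measurable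
  also have "\<dots> = (\<Prod>i<n. 1)"
  proof (rule prod.cong[OF refl])
    fix i show "(\<integral>\<^sup>+ t. ennreal (std_normal_density t) * (if i = j then ennreal (t\<^sup>2) else 1) \<partial>lborel) = 1"
      by (cases "i = j") (simp_all add: nn_integral_std_normal_moment)
  qed
  finally show ?thesis by simp
qed

text \<open>A null measure could not carry the standard normal density, whose mass is \<open>1\<close>.\<close>

lemma ae_filter_lborel_vec_neq_bot: "ae_filter (lborel_vec n) \<noteq> bot"
proof
  assume "ae_filter (lborel_vec n) = bot"
  then have "AE x in lborel_vec n. ennreal (std_normal_vec n x) = 0"
    by (metis eventually_bot)
  then have "(\<integral>\<^sup>+ x. ennreal (std_normal_vec n x) \<partial>lborel_vec n) = 0"
    by (subst nn_integral_0_iff_AE) auto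
  then show False
    by (simp add: nn_integral_std_normal_vec)
qed

text \<open>A surjective linear map pulls null sets back to null sets and reflects them. Both directions
  come from integrating over the pairs \<open>(z, y)\<close> with \<open>P (z + A y)\<close>. For fixed \<open>y\<close> the condition on
  \<open>z\<close> is a translate of \<open>P\<close>. For fixed \<open>z = A x\<close> the condition on \<open>y\<close> is \<open>P (A (y + x))\<close>, a
  translate of \<open>P (A y)\<close>. As Lebesgue measure is translation invariant, Fubini's theorem compares
  the two.\<close>

lemma AE_lborel_vec_surj_iff:
  assumes A: "A \<in> carrier_mat k n"
    and surj: "\<And>z. z \<in> carrier_vec k \<Longrightarrow> \<exists>x\<in>carrier_vec n. A *\<^sub>v x = z"
    and P[measurable]: "{z \<in> space (lborel_vec k). P z} \<in> sets (lborel_vec k)"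
  shows "(AE y in lborel_vec n. P (A *\<^sub>v y)) \<longleftrightarrow> (AE z in lborel_vec k. P z)"
proof -
  interpret k: sigma_finite_measure "lborel_vec k" by (rule sigma_finite_lborel_vec)
  interpret n: sigma_finite_measure "lborel_vec n" by (rule sigma_finite_lborel_vec)
  interpret pair_sigma_finite "lborel_vec k" "lborel_vec n" ..
  have sum: "(\<lambda>p. fst p + A *\<^sub>v snd p) \<in> measurable (lborel_vec k \<Otimes>\<^sub>M lborel_vec n) (lborel_vec k)"
    by (intro measurable_vec_add measurable_fst measurable_compose[OF measurable_snd]
        measurable_mult_mat_vec A)
  have PA: "{y \<in> space (lborel_vec n). P (A *\<^sub>v y)} \<in> sets (lborel_vec n)"
    using measurable_sets_Collect[OF measurable_mult_mat_vec[OF A] P] .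
  have "{p \<in> space (lborel_vec k \<Otimes>\<^sub>M lborel_vec n). P (fst p + A *\<^sub>v snd p)}
      \<in> sets (lborel_vec k \<Otimes>\<^sub>M lborel_vec n)"
    using measurable_sets_Collect[OF sum P] .
  then have comm: "(AE z in lborel_vec k. AE y in lborel_vec n. P (z + A *\<^sub>v y)) \<longleftrightarrow>
      (AE y in lborel_vec n. AE z in lborel_vec k. P (z + A *\<^sub>v y))"
    by (intro AE_commute) simp
  have "(AE y in lborel_vec n. P (z + A *\<^sub>v y)) \<longleftrightarrow> (AE y in lborel_vec n. P (A *\<^sub>v y))"
    if z: "z \<in> carrier_vec k" for z
  proof -
    obtain x where x: "x \<in> carrier_vec n" and zx: "A *\<^sub>v x = z"
      using surj[OF z] by blast
    have "z + A *\<^sub>v y = A *\<^sub>v (y + x)" if "y \<in> carrier_vec n" for y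
      using A x z that by (subst mult_add_distrib_mat_vec[OF A]) (auto simp: zx comm_add_vec[of _ k])
    then have "(AE y in lborel_vec n. P (z + A *\<^sub>v y)) \<longleftrightarrow> (AE y in lborel_vec n. P (A *\<^sub>v (y + x)))"
      by (intro AE_cong) (auto simp: space_lborel_vec)
    also have "\<dots> \<longleftrightarrow> (AE y in lborel_vec n. P (A *\<^sub>v y))"
      by (rule AE_lborel_vec_translate[OF x PA])
    finally show ?thesis .
  qed
  then have l: "(AE z in lborel_vec k. AE y in lborel_vec n. P (z + A *\<^sub>v y)) \<longleftrightarrow>
      (AE z in lborel_vec k. AE y in lborel_vec n. P (A *\<^sub>v y))"
    by (rule AE_cong) (simp add: space_lborel_vec)
  have "(AE z in lborel_vec k. P (z + A *\<^sub>v y)) \<longleftrightarrow> (AE z in lborel_vec k. P z)"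
    if "y \<in> carrier_vec n" for y
    by (rule AE_lborel_vec_translate[OF _ P]) (use A that in auto)
  then have r: "(AE y in lborel_vec n. AE z in lborel_vec k. P (z + A *\<^sub>v y)) \<longleftrightarrow>
      (AE y in lborel_vec n. AE z in lborel_vec k. P z)"
    by (rule AE_cong) (simp add: space_lborel_vec)
  show ?thesis
    using l r comm ae_filter_lborel_vec_neq_bot by (simp add: eventually_const)
qed

section \<open>The quadratic loss\<close>

lemma quad_form_sum:
  fixes A :: "real mat"
  assumes A: "A \<in> carrier_mat m m" and v: "v \<in> carrier_vec m"
  shows "v \<bullet> (A *\<^sub>v v) = (\<Sum>i<m. \<Sum>j<m. A $$ (i, j) * (v $ i * v $ j))"
  using assms
  by (auto simp: scalar_prod_def sum_distrib_left lessThan_atLeast0 mult_ac intro!: sum.cong)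

lemma quad_form_add:
  fixes Q :: "real mat"
  assumes Q: "Q \<in> carrier_mat m m" and sym: "transpose_mat Q = Q"
    and a: "a \<in> carrier_vec m" and b: "b \<in> carrier_vec m"
  shows "(a + b) \<bullet> (Q *\<^sub>v (a + b)) = a \<bullet> (Q *\<^sub>v a) + 2 * (a \<bullet> (Q *\<^sub>v b)) + b \<bullet> (Q *\<^sub>v b)"
proof -
  have Qa: "Q *\<^sub>v a \<in> carrier_vec m" and Qb: "Q *\<^sub>v b \<in> carrier_vec m"
    using Q a b by auto
  have "b \<bullet> (Q *\<^sub>v a) = (transpose_mat Q *\<^sub>v b) \<bullet> a"
    using transpose_vec_mult_scalar[OF Q a b] by simp
  also have "\<dots> = a \<bullet> (Q *\<^sub>v b)"
    using a Qb by (simp add: sym comm_scalar_prod)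
  finally have "b \<bullet> (Q *\<^sub>v a) = a \<bullet> (Q *\<^sub>v b)" .
  then show ?thesis
    using Q a b Qa Qb
    by (simp add: mult_add_distrib_mat_vec[OF Q] add_scalar_prod_distrib[of _ m] scalar_prod_add_distrib[of _ m])
qed

lemma quad_form_smult:
  fixes Q :: "real mat"
  assumes Q: "Q \<in> carrier_mat m m" and a: "a \<in> carrier_vec m"
  shows "(c \<cdot>\<^sub>v a) \<bullet> (Q *\<^sub>v (c \<cdot>\<^sub>v a)) = c\<^sup>2 * (a \<bullet> (Q *\<^sub>v a))"
  using assms by (simp add: mult_mat_vec[OF Q] power2_eq_square)

lemma quad_form_le:
  fixes A :: "real mat"
  assumes A: "A \<in> carrier_mat m m"
  obtains D where "0 \<le> D" and "\<And>v. v \<in> carrier_vec m \<Longrightarrow> v \<bullet> (A *\<^sub>v v) \<le> D * (\<Sum>i<m. (v $ i)\<^sup>2)"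
proof
  show "0 \<le> (\<Sum>i<m. \<Sum>j<m. \<bar>A $$ (i, j)\<bar>)"
    by (intro sum_nonneg) auto
  fix v :: "real vec" assume v: "v \<in> carrier_vec m"
  let ?N = "\<Sum>i<m. (v $ i)\<^sup>2"
  have N: "(v $ i)\<^sup>2 \<le> ?N" if "i < m" for i
    using that by (intro member_le_sum) auto
  have "A $$ (i, j) * (v $ i * v $ j) \<le> \<bar>A $$ (i, j)\<bar> * ?N" if "i < m" "j < m" for i j
  proof -
    have "2 * \<bar>v $ i * v $ j\<bar> \<le> (v $ i)\<^sup>2 + (v $ j)\<^sup>2"
      using sum_squares_bound[of "\<bar>v $ i\<bar>" "\<bar>v $ j\<bar>"] by (simp add: abs_mult)
    then have "\<bar>v $ i * v $ j\<bar> \<le> ?N"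
      using N[OF that(1)] N[OF that(2)] by linarith
    then have "\<bar>A $$ (i, j)\<bar> * \<bar>v $ i * v $ j\<bar> \<le> \<bar>A $$ (i, j)\<bar> * ?N"
      by (rule mult_left_mono) simp
    moreover have "A $$ (i, j) * (v $ i * v $ j) \<le> \<bar>A $$ (i, j)\<bar> * \<bar>v $ i * v $ j\<bar>"
      unfolding abs_mult[symmetric] by (rule abs_ge_self)
    ultimately show ?thesis
      by linarith
  qed
  then show "v \<bullet> (A *\<^sub>v v) \<le> (\<Sum>i<m. \<Sum>j<m. \<bar>A $$ (i, j)\<bar>) * ?N"
    unfolding quad_form_sum[OF A v] sum_distrib_right by (intro sum_mono) auto
qed

lemma mult_mat_vec_zero_vec:
  fixes A :: "real mat"
  assumes "A \<in> carrier_mat k n"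
  shows "A *\<^sub>v 0\<^sub>v n = 0\<^sub>v k"
  using assms by (intro eq_vecI) auto

lemma sym_pos_def_nonneg:
  assumes "sym_pos_def m Q" "v \<in> carrier_vec m"
  shows "0 \<le> v \<bullet> (Q *\<^sub>v v)"
proof (cases "v = 0\<^sub>v m")
  case True
  then show ?thesis
    using assms by (auto simp: sym_pos_def_def)
next
  case False
  then show ?thesis
    using assms by (auto simp: sym_pos_def_def less_imp_le)
qed

lemma sym_pos_def_inverse:
  assumes Q: "sym_pos_def m Q"
  shows "the (mat_inverse Q) \<in> carrier_mat m m" "Q * the (mat_inverse Q) = 1\<^sub>m m"
proof -
  have Qc: "Q \<in> carrier_mat m m"
    using Q by (simp add: sym_pos_def_def)
  have "det Q \<noteq> 0"
  proof
    assume "det Q = 0"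
    then obtain v where v: "v \<in> carrier_vec m" "v \<noteq> 0\<^sub>v m" "Q *\<^sub>v v = 0\<^sub>v m"
      using det_0_iff_vec_prod_zero_field[OF Qc] by blast
    then show False
      using Q by (auto simp: sym_pos_def_def dest!: bspec[of _ _ v])
  qed
  then have "mat_inverse Q \<noteq> None"
    using mat_inverse(1)[OF Qc, where b = "()"] det_non_zero_imp_unit[OF Qc, where b = "()"] by blast
  then obtain B where "mat_inverse Q = Some B"
    by blast
  then show "the (mat_inverse Q) \<in> carrier_mat m m" "Q * the (mat_inverse Q) = 1\<^sub>m m"
    using mat_inverse(2)[OF Qc] by auto
qed

text \<open>With \<open>b = Q\<^sup>-\<^sup>1 e\<^sub>i\<close> one has \<open>v\<^sup>T Q b = v\<^sub>i\<close>, so this is the Cauchy--Schwarz inequality for the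
  inner product given by \<open>Q\<close>, with constant \<open>K = b\<^sup>T Q b\<close>.\<close>

lemma sym_pos_def_coord_bound:
  assumes Q: "sym_pos_def m Q" and i: "i < m"
  obtains K where "0 \<le> K" and "\<And>v. v \<in> carrier_vec m \<Longrightarrow> (v $ i)\<^sup>2 \<le> K * (v \<bullet> (Q *\<^sub>v v))"
proof -
  have Qc: "Q \<in> carrier_mat m m" and sym: "transpose_mat Q = Q"
    using Q by (auto simp: sym_pos_def_def)
  let ?B = "the (mat_inverse Q)"
  note B = sym_pos_def_inverse[OF Q]
  define b where "b = ?B *\<^sub>v unit_vec m i"
  have b: "b \<in> carrier_vec m"
    using B by (auto simp: b_def)
  have Qb: "Q *\<^sub>v b = unit_vec m i"
    unfolding b_def using B by (subst assoc_mult_mat_vec[OF Qc B(1), symmetric]) auto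
  define \<beta> where "\<beta> = b \<bullet> (Q *\<^sub>v b)"
  have "b \<noteq> 0\<^sub>v m"
  proof
    assume "b = 0\<^sub>v m"
    then have "unit_vec m i = (0\<^sub>v m :: real vec)"
      using Qb mult_mat_vec_zero_vec[OF Qc] by simp
    then have "unit_vec m i $ i = (0\<^sub>v m :: real vec) $ i"
      by simp
    with i show False by simp
  qed
  then have \<beta>: "0 < \<beta>"
    using Q b by (simp add: sym_pos_def_def \<beta>_def)
  have "(v $ i)\<^sup>2 \<le> \<beta> * (v \<bullet> (Q *\<^sub>v v))" if v: "v \<in> carrier_vec m" for v
  proof -
    \<comment> \<open>the minimizer of the quadratic polynomial \<open>(v + c b)\<^sup>T Q (v + c b)\<close> in \<open>c\<close>\<close>
    define c where "c = - (v $ i / \<beta>)"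
    have "0 \<le> (v + c \<cdot>\<^sub>v b) \<bullet> (Q *\<^sub>v (v + c \<cdot>\<^sub>v b))"
      using v b by (intro sym_pos_def_nonneg[OF Q]) auto
    also have "\<dots> = v \<bullet> (Q *\<^sub>v v) + 2 * (v \<bullet> (Q *\<^sub>v (c \<cdot>\<^sub>v b))) + c\<^sup>2 * \<beta>"
      using quad_form_add[OF Qc sym v, of "c \<cdot>\<^sub>v b"] quad_form_smult[OF Qc b, of c] b
      by (simp add: \<beta>_def)
    also have "v \<bullet> (Q *\<^sub>v (c \<cdot>\<^sub>v b)) = c * v $ i"
      using v b i by (simp add: mult_mat_vec[OF Qc b] Qb)
    also have "v \<bullet> (Q *\<^sub>v v) + 2 * (c * v $ i) + c\<^sup>2 * \<beta> = v \<bullet> (Q *\<^sub>v v) - (v $ i)\<^sup>2 / \<beta>"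
      using \<beta> by (simp add: c_def power2_eq_square field_simps)
    finally show ?thesis
      using \<beta> by (simp add: field_simps)
  qed
  with \<beta> show ?thesis
    by (intro that[of \<beta>]) auto
qed

lemma sym_pos_def_coercive:
  assumes Q: "sym_pos_def m Q"
  obtains K where "0 \<le> K"
    and "\<And>v i. v \<in> carrier_vec m \<Longrightarrow> i < m \<Longrightarrow> (v $ i)\<^sup>2 \<le> K * (v \<bullet> (Q *\<^sub>v v))"
proof -
  have "\<forall>i\<in>{..<m}. \<exists>K. 0 \<le> K \<and> (\<forall>v\<in>carrier_vec m. (v $ i)\<^sup>2 \<le> K * (v \<bullet> (Q *\<^sub>v v)))"
    using sym_pos_def_coord_bound[OF Q] by (metis lessThan_iff)
  then obtain K where K: "\<And>i. i < m \<Longrightarrow> 0 \<le> K i"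
    "\<And>i v. i < m \<Longrightarrow> v \<in> carrier_vec m \<Longrightarrow> (v $ i)\<^sup>2 \<le> K i * (v \<bullet> (Q *\<^sub>v v))"
    unfolding bchoice_iff by auto
  have "(v $ i)\<^sup>2 \<le> (\<Sum>i<m. K i) * (v \<bullet> (Q *\<^sub>v v))" if "v \<in> carrier_vec m" "i < m" for v i
  proof -
    have "K i \<le> (\<Sum>i<m. K i)"
      using that K(1) by (intro member_le_sum) auto
    then show ?thesis
      using K(2)[OF that(2,1)] sym_pos_def_nonneg[OF Q that(1)] by (meson mult_right_mono order_trans)
  qed
  with K(1) show ?thesis
    by (intro that[of "\<Sum>i<m. K i"]) (auto intro: sum_nonneg)
qed

text \<open>Completing the square around the full-information optimum \<open>u = - Q\<^sup>-\<^sup>1 S y\<close>.\<close>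

lemma team_loss_eq_quad_form:
  assumes Q: "sym_pos_def m Q" and S: "S \<in> carrier_mat m l"
    and u: "u \<in> carrier_vec m" and y: "y \<in> carrier_vec l"
  defines "w \<equiv> u + (the (mat_inverse Q) * S) *\<^sub>v y"
  shows "team_loss Q S u y = 1/2 * (w \<bullet> (Q *\<^sub>v w))"
proof -
  have Qc: "Q \<in> carrier_mat m m" and sym: "transpose_mat Q = Q"
    using Q by (auto simp: sym_pos_def_def)
  let ?B = "the (mat_inverse Q)"
  note B = sym_pos_def_inverse[OF Q]
  define p where "p = ?B *\<^sub>v (S *\<^sub>v y)"
  have Sy: "S *\<^sub>v y \<in> carrier_vec m" and p: "p \<in> carrier_vec m"
    using S y B by (auto simp: p_def)
  have w: "w = u + p"
    using B S y by (simp add: w_def p_def)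
  have Qp: "Q *\<^sub>v p = S *\<^sub>v y"
    unfolding p_def using B Sy by (subst assoc_mult_mat_vec[OF Qc B(1), symmetric]) auto
  have St: "transpose_mat S \<in> carrier_mat l m"
    using S by auto
  have "(transpose_mat S * ?B * S) *\<^sub>v y = transpose_mat S *\<^sub>v p"
    unfolding p_def using B St S y Sy
    by (simp add: assoc_mult_mat_vec[of _ l m _ l] assoc_mult_mat_vec[of _ l m _ m] )
  then have "y \<bullet> ((transpose_mat S * ?B * S) *\<^sub>v y) = y \<bullet> (transpose_mat S *\<^sub>v p)"
    by simp
  also have "\<dots> = (transpose_mat S *\<^sub>v p) \<bullet> y"
    using St p y by (intro comm_scalar_prod[of _ l]) auto
  also have "\<dots> = p \<bullet> (S *\<^sub>v y)"
    by (rule transpose_vec_mult_scalar[OF S y p])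
  finally show ?thesis
    unfolding team_loss_def w quad_form_add[OF Qc sym u p] Qp by (simp add: field_simps)
qed

lemma team_loss_nonneg:
  assumes "sym_pos_def m Q" "S \<in> carrier_mat m l" "u \<in> carrier_vec m" "y \<in> carrier_vec l"
  shows "0 \<le> team_loss Q S u y"
proof -
  have "u + (the (mat_inverse Q) * S) *\<^sub>v y \<in> carrier_vec m"
    using assms sym_pos_def_inverse(1)[OF assms(1)] by auto
  then show ?thesis
    using sym_pos_def_nonneg[OF assms(1)] by (simp add: team_loss_eq_quad_form[OF assms])
qed

lemma quad_form_add_le:
  assumes Q: "sym_pos_def m Q" and a: "a \<in> carrier_vec m" and b: "b \<in> carrier_vec m"
  shows "(a + b) \<bullet> (Q *\<^sub>v (a + b)) \<le> 2 * (a \<bullet> (Q *\<^sub>v a)) + 2 * (b \<bullet> (Q *\<^sub>v b))"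
proof -
  have Qc: "Q \<in> carrier_mat m m" and sym: "transpose_mat Q = Q"
    using Q by (auto simp: sym_pos_def_def)
  let ?b = "(-1) \<cdot>\<^sub>v b"
  have "0 \<le> (a + ?b) \<bullet> (Q *\<^sub>v (a + ?b))"
    using a b by (intro sym_pos_def_nonneg[OF Q]) auto
  also have "\<dots> = a \<bullet> (Q *\<^sub>v a) - 2 * (a \<bullet> (Q *\<^sub>v b)) + b \<bullet> (Q *\<^sub>v b)"
    using quad_form_add[OF Qc sym a, of ?b] quad_form_smult[OF Qc b, of "-1"] a b Qc
    by (simp add: mult_mat_vec[OF Qc b])
  finally show ?thesis
    unfolding quad_form_add[OF Qc sym a b] by linarith
qed

text \<open>This gives an integrable majorant for the loss of every bounded profile, whose expectation is
  known exactly because it only involves second moments.\<close>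

lemma team_loss_upper:
  assumes Q: "sym_pos_def m Q" and S: "S \<in> carrier_mat m l"
  obtains K where "0 \<le> K" and "\<And>u y. u \<in> carrier_vec m \<Longrightarrow> y \<in> carrier_vec l \<Longrightarrow>
    team_loss Q S u y \<le> K * ((\<Sum>i<m. (u $ i)\<^sup>2) + (\<Sum>j<l. (y $ j)\<^sup>2))"
proof -
  have Qc: "Q \<in> carrier_mat m m"
    using Q by (auto simp: sym_pos_def_def)
  let ?P = "the (mat_inverse Q) * S"
  have P: "?P \<in> carrier_mat m l"
    using S sym_pos_def_inverse[OF Q] by auto
  obtain D where D: "0 \<le> D" "\<And>v. v \<in> carrier_vec m \<Longrightarrow> v \<bullet> (Q *\<^sub>v v) \<le> D * (\<Sum>i<m. (v $ i)\<^sup>2)"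
    using quad_form_le[OF Qc] by blast
  have T: "transpose_mat ?P * Q * ?P \<in> carrier_mat l l"
    using P Qc by auto
  obtain E where E: "0 \<le> E"
    "\<And>y. y \<in> carrier_vec l \<Longrightarrow> y \<bullet> ((transpose_mat ?P * Q * ?P) *\<^sub>v y) \<le> E * (\<Sum>j<l. (y $ j)\<^sup>2)"
    using quad_form_le[OF T] by blast
  have "team_loss Q S u y \<le> (D + E) * ((\<Sum>i<m. (u $ i)\<^sup>2) + (\<Sum>j<l. (y $ j)\<^sup>2))"
    if u: "u \<in> carrier_vec m" and y: "y \<in> carrier_vec l" for u y
  proof -
    define p where "p = ?P *\<^sub>v y"
    have p: "p \<in> carrier_vec m"
      unfolding p_def using P y by auto
    have "(transpose_mat ?P * Q * ?P) *\<^sub>v y = transpose_mat ?P *\<^sub>v (Q *\<^sub>v p)"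
      unfolding p_def using P Qc y
      by (subst assoc_mult_mat_vec[of _ l m _ l], auto)
    then have "y \<bullet> ((transpose_mat ?P * Q * ?P) *\<^sub>v y) = (transpose_mat ?P *\<^sub>v (Q *\<^sub>v p)) \<bullet> y"
      using P Qc p y by (simp add: comm_scalar_prod[of y l])
    also have "\<dots> = (Q *\<^sub>v p) \<bullet> p"
      unfolding p_def[symmetric] using transpose_vec_mult_scalar[OF P y, of "Q *\<^sub>v p"] Qc p
      by (simp add: p_def)
    also have "\<dots> = p \<bullet> (Q *\<^sub>v p)"
      using Qc p by (intro comm_scalar_prod[of _ m]) auto
    finally have pE: "p \<bullet> (Q *\<^sub>v p) \<le> E * (\<Sum>j<l. (y $ j)\<^sup>2)"
      using E(2)[OF y] by simp
    have "team_loss Q S u y \<le> u \<bullet> (Q *\<^sub>v u) + p \<bullet> (Q *\<^sub>v p)"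
      using quad_form_add_le[OF Q u p] by (simp add: team_loss_eq_quad_form[OF Q S u y] p_def)
    also have "\<dots> \<le> D * (\<Sum>i<m. (u $ i)\<^sup>2) + E * (\<Sum>j<l. (y $ j)\<^sup>2)"
      using pE D(2)[OF u] by linarith
    also have "\<dots> \<le> (D + E) * ((\<Sum>i<m. (u $ i)\<^sup>2) + (\<Sum>j<l. (y $ j)\<^sup>2))"
      using D(1) E(1) by (simp add: algebra_simps sum_nonneg)
    finally show ?thesis .
  qed
  with D(1) E(1) show ?thesis
    by (intro that[of "D + E"]) auto
qed

text \<open>Finite cost thus forces square-integrable controls, as long as the second moments of \<open>y\<close> are
  finite.\<close>

lemma team_loss_coercive:
  assumes Q: "sym_pos_def m Q" and S: "S \<in> carrier_mat m l"
  obtains K where "0 \<le> K" and "\<And>u y i. u \<in> carrier_vec m \<Longrightarrow> y \<in> carrier_vec l \<Longrightarrow> i < m \<Longrightarrow>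
    (u $ i)\<^sup>2 \<le> K * (team_loss Q S u y + (\<Sum>j<l. (y $ j)\<^sup>2))"
proof -
  let ?P = "the (mat_inverse Q) * S"
  have P: "?P \<in> carrier_mat m l"
    using S sym_pos_def_inverse[OF Q] by auto
  obtain K where K: "0 \<le> K" "\<And>v i. v \<in> carrier_vec m \<Longrightarrow> i < m \<Longrightarrow> (v $ i)\<^sup>2 \<le> K * (v \<bullet> (Q *\<^sub>v v))"
    using sym_pos_def_coercive[OF Q] by blast
  obtain D where D: "0 \<le> D" "\<And>u y. u \<in> carrier_vec m \<Longrightarrow> y \<in> carrier_vec l \<Longrightarrow>
    team_loss Q S u y \<le> D * ((\<Sum>i<m. (u $ i)\<^sup>2) + (\<Sum>j<l. (y $ j)\<^sup>2))"
    using team_loss_upper[OF Q S] by blast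
  have "(u $ i)\<^sup>2 \<le> (4 * K + 4 * K * D) * (team_loss Q S u y + (\<Sum>j<l. (y $ j)\<^sup>2))"
    if u: "u \<in> carrier_vec m" and y: "y \<in> carrier_vec l" and i: "i < m" for u y i
  proof -
    define p where "p = ?P *\<^sub>v y"
    have p: "p \<in> carrier_vec m"
      unfolding p_def using P y by auto
    have up: "((u + p) $ i)\<^sup>2 \<le> 2 * K * team_loss Q S u y"
      using K(2)[of "u + p" i] u p i by (simp add: team_loss_eq_quad_form[OF Q S u y] p_def)
    have "(p $ i)\<^sup>2 \<le> 2 * K * team_loss Q S (0\<^sub>v m) y"
      using K(2)[of p i] p i by (simp add: team_loss_eq_quad_form[OF Q S _ y] p_def)
    also have "\<dots> \<le> 2 * K * (D * (\<Sum>j<l. (y $ j)\<^sup>2))"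
      using K(1) D(2)[OF _ y, of "0\<^sub>v m"] by (intro mult_left_mono) auto
    finally have p2: "(p $ i)\<^sup>2 \<le> 2 * K * (D * (\<Sum>j<l. (y $ j)\<^sup>2))" .
    have "(u $ i)\<^sup>2 = ((u + p) $ i - p $ i)\<^sup>2"
      using u p i by simp
    also have "\<dots> \<le> 2 * ((u + p) $ i)\<^sup>2 + 2 * (p $ i)\<^sup>2"
      using zero_le_power2[of "(u + p) $ i + p $ i"] by (simp add: power2_eq_square algebra_simps)
    also have "\<dots> \<le> 4 * K * team_loss Q S u y + 4 * K * D * (\<Sum>j<l. (y $ j)\<^sup>2)"
      using up p2 by simp
    also have "\<dots> \<le> (4 * K + 4 * K * D) * (team_loss Q S u y + (\<Sum>j<l. (y $ j)\<^sup>2))"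
      using K(1) D(1) team_loss_nonneg[OF Q S u y] by (simp add: algebra_simps sum_nonneg)
    finally show ?thesis .
  qed
  with K(1) D(1) show ?thesis
    by (intro that[of "4 * K + 4 * K * D"]) auto
qed

text \<open>Strict convexity of the loss in the controls, quantified.\<close>

lemma team_loss_midpoint:
  assumes Q: "sym_pos_def m Q" and S: "S \<in> carrier_mat m l"
  obtains K where "0 < K" and "\<And>u u' y i. u \<in> carrier_vec m \<Longrightarrow> u' \<in> carrier_vec m \<Longrightarrow> y \<in> carrier_vec l \<Longrightarrow> i < m \<Longrightarrow>
    (u $ i - u' $ i)\<^sup>2 + K * team_loss Q S ((1/2) \<cdot>\<^sub>v (u + u')) y
      \<le> K/2 * (team_loss Q S u y + team_loss Q S u' y)"
proof -
  have Qc: "Q \<in> carrier_mat m m" and sym: "transpose_mat Q = Q"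
    using Q by (auto simp: sym_pos_def_def)
  let ?P = "the (mat_inverse Q) * S"
  have P: "?P \<in> carrier_mat m l"
    using S sym_pos_def_inverse[OF Q] by auto
  obtain K where K: "0 \<le> K" "\<And>v i. v \<in> carrier_vec m \<Longrightarrow> i < m \<Longrightarrow> (v $ i)\<^sup>2 \<le> K * (v \<bullet> (Q *\<^sub>v v))"
    using sym_pos_def_coercive[OF Q] by blast
  have "(u $ i - u' $ i)\<^sup>2 + (8 * K + 1) * team_loss Q S ((1/2) \<cdot>\<^sub>v (u + u')) y
      \<le> (8 * K + 1)/2 * (team_loss Q S u y + team_loss Q S u' y)"
    if u: "u \<in> carrier_vec m" and u': "u' \<in> carrier_vec m" and y: "y \<in> carrier_vec l" and i: "i < m" for u u' y i
  proof -
    \<comment> \<open>the parallelogram law for the inner product given by \<open>Q\<close>\<close>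
    define a where "a = (1/2) \<cdot>\<^sub>v (u + u') + ?P *\<^sub>v y"
    define d where "d = (1/2) \<cdot>\<^sub>v (u - u')"
    have a: "a \<in> carrier_vec m" and d: "d \<in> carrier_vec m"
      using u u' P y by (auto simp: a_def d_def)
    have md: "(-1) \<cdot>\<^sub>v d \<in> carrier_vec m"
      using d by auto
    have eq: "u + ?P *\<^sub>v y = a + d" "u' + ?P *\<^sub>v y = a + (-1) \<cdot>\<^sub>v d"
      using u u' P y unfolding a_def d_def by (auto intro!: eq_vecI simp: field_simps)
    have "a \<bullet> (Q *\<^sub>v ((-1) \<cdot>\<^sub>v d)) = - (a \<bullet> (Q *\<^sub>v d))"
      using a d Qc by (simp add: mult_mat_vec[OF Qc d])
    then have sum: "team_loss Q S u y + team_loss Q S u' y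
        = 2 * team_loss Q S ((1/2) \<cdot>\<^sub>v (u + u')) y + d \<bullet> (Q *\<^sub>v d)"
      using u u' y quad_form_smult[OF Qc d, of "-1"]
      by (simp add: team_loss_eq_quad_form[OF Q S _ y] eq quad_form_add[OF Qc sym a d]
          quad_form_add[OF Qc sym a md] field_simps flip: a_def)
    have "(u $ i - u' $ i)\<^sup>2 = 4 * (d $ i)\<^sup>2"
      using u u' i by (simp add: d_def power_divide)
    also have "\<dots> \<le> 4 * K * (d \<bullet> (Q *\<^sub>v d))"
      using K(2)[OF d i] by simp
    also have "\<dots> \<le> (8 * K + 1) / 2 * (d \<bullet> (Q *\<^sub>v d))"
      using sym_pos_def_nonneg[OF Q d] by (simp add: algebra_simps)
    finally have "(u $ i - u' $ i)\<^sup>2 \<le> (8 * K + 1) / 2 * (d \<bullet> (Q *\<^sub>v d))" .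
    moreover have "c / 2 * (2 * s + t) = c * s + c / 2 * t" for c s t :: real
      by (simp add: field_simps)
    ultimately show ?thesis
      unfolding sum by simp
  qed
  with K(1) show ?thesis
    by (intro that[of "8 * K + 1"]) auto
qed

text \<open>The polynomial form makes measurability and continuity in the controls evident.\<close>

lemma team_loss_coord:
  assumes Q: "sym_pos_def m Q" and S: "S \<in> carrier_mat m l"
  obtains P :: "real mat" where "\<And>u y. y \<in> carrier_vec l \<Longrightarrow>
    team_loss Q S (vec m u) y = 1/2 * (\<Sum>i<m. \<Sum>j<m. Q $$ (i, j) *
      ((u i + (\<Sum>k<l. P $$ (i, k) * y $ k)) * (u j + (\<Sum>k<l. P $$ (j, k) * y $ k))))"
proof -
  have Qc: "Q \<in> carrier_mat m m"
    using Q by (auto simp: sym_pos_def_def)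
  define P where "P = the (mat_inverse Q) * S"
  have P: "P \<in> carrier_mat m l"
    using S sym_pos_def_inverse[OF Q] by (auto simp: P_def)
  have "team_loss Q S (vec m u) y = 1/2 * (\<Sum>i<m. \<Sum>j<m. Q $$ (i, j) *
      ((u i + (\<Sum>k<l. P $$ (i, k) * y $ k)) * (u j + (\<Sum>k<l. P $$ (j, k) * y $ k))))"
    if y: "y \<in> carrier_vec l" for u y
  proof -
    define w where "w = vec m u + P *\<^sub>v y"
    have w: "w \<in> carrier_vec m"
      unfolding w_def by (intro add_carrier_vec vec_carrier mult_mat_vec_carrier[OF P y])
    have wi: "w $ i = u i + (\<Sum>k<l. P $$ (i, k) * y $ k)" if "i < m" for i
      using that P mult_mat_vec_index_sum[OF P y that] by (simp add: w_def)
    have "team_loss Q S (vec m u) y = 1/2 * (w \<bullet> (Q *\<^sub>v w))"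
      using team_loss_eq_quad_form[OF Q S vec_carrier y] by (simp only: w_def P_def)
    also have "\<dots> = 1/2 * (\<Sum>i<m. \<Sum>j<m. Q $$ (i, j) * (w $ i * w $ j))"
      by (simp only: quad_form_sum[OF Qc w])
    finally show ?thesis
      by (simp add: wi)
  qed
  then show ?thesis
    by (rule that)
qed

text \<open>A maximal independent set of columns has as many elements as there are rows, hence is a basis.\<close>

lemma full_row_rank_surj:
  assumes A: "A \<in> carrier_mat k n" and full: "full_row_rank A" and z: "z \<in> carrier_vec k"
  shows "\<exists>x\<in>carrier_vec n. A *\<^sub>v x = z"
proof -
  interpret vec_space "TYPE(real)" k .
  have rank: "rank A = k"
    using A full by (simp add: full_row_rank_def)
  let ?P = "\<lambda>T. T \<subseteq> set (cols A) \<and> lin_indpt T"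
  have "\<exists>T. finite T \<and> maximal T ?P"
    using maximal_exists_superset[of "set (cols A)" ?P "{}"] by (auto simp: lin_dep_def)
  then obtain T where T: "maximal T ?P"
    by blast
  then have T': "T \<subseteq> set (cols A)" "lin_indpt T"
    by (auto simp: maximal_def)
  have cols: "set (cols A) \<subseteq> carrier_vec k"
    using A cols_dim by blast
  have "card T = k"
    using rank_card_indpt[OF A T] rank by simp
  then have "basis T"
    using T' cols fin_dim finite_subset[OF T'(1)] by (intro dim_li_is_basis) (auto simp: dim_is_n)
  then have "carrier_vec k = span T"
    by (auto simp: basis_def)
  also have "\<dots> \<subseteq> col_space A"
    unfolding col_space_def using T'(1) by (rule span_is_monotone)
  also have "\<dots> = {y \<in> carrier_vec (dim_row A). \<exists>x\<in>carrier_vec (dim_col A). A *\<^sub>v x = y}"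
    by (rule col_space_eq[OF A])
  finally show ?thesis
    using A z by auto
qed

section \<open>Projections of isotropic random vectors\<close>

text \<open>The columns of \<open>r\<close> are orthonormal, so the projection \<open>r\<^sup>T X\<close> has covariance \<open>r\<^sup>T r = I\<close>. Its
  second moments are therefore those of the standard normal law, not merely close to them.\<close>

lemma nn_integral_isotropic_projection:
  assumes iso: "isotropic n M X" and r: "r \<in> stiefel n l" and j: "j < l"
  shows "(\<integral>\<^sup>+ \<omega>. ennreal (((transpose_mat r *\<^sub>v X \<omega>) $ j)\<^sup>2) \<partial>M) = 1"
proof -
  have X: "X \<in> measurable M (lborel_vec n)"
    and sq: "\<And>i. i < n \<Longrightarrow> integrable M (\<lambda>\<omega>. (X \<omega> $ i)\<^sup>2)"
    and mean: "mean_vec n M X = 0\<^sub>v n" and cov: "cov_mat n M X = 1\<^sub>m n"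
    using iso by (auto simp: isotropic_def)
  have rc: "r \<in> carrier_mat n l" and rr: "transpose_mat r * r = 1\<^sub>m l"
    using r by (auto simp: stiefel_def)
  have Xi[measurable]: "(\<lambda>\<omega>. X \<omega> $ i) \<in> borel_measurable M" if "i < n" for i
    using measurable_compose[OF X measurable_vec_index[OF that]] .
  have int: "integrable M (\<lambda>\<omega>. X \<omega> $ i * X \<omega> $ k)" if "i < n" "k < n" for i k
  proof (rule Bochner_Integration.integrable_bound)
    show "integrable M (\<lambda>\<omega>. (X \<omega> $ i)\<^sup>2 + (X \<omega> $ k)\<^sup>2)"
      using sq that by auto
    show "(\<lambda>\<omega>. X \<omega> $ i * X \<omega> $ k) \<in> borel_measurable M"
      using that by measurable
    have "\<bar>a * b\<bar> \<le> a\<^sup>2 + b\<^sup>2" for a b :: real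
    proof -
      have "2 * (\<bar>a\<bar> * \<bar>b\<bar>) \<le> a\<^sup>2 + b\<^sup>2"
        using sum_squares_bound[of "\<bar>a\<bar>" "\<bar>b\<bar>"] by (simp add: mult.assoc)
      moreover have "0 \<le> \<bar>a\<bar> * \<bar>b\<bar>"
        by simp
      ultimately show ?thesis
        unfolding abs_mult by linarith
    qed
    then show "AE \<omega> in M. norm (X \<omega> $ i * X \<omega> $ k) \<le> norm ((X \<omega> $ i)\<^sup>2 + (X \<omega> $ k)\<^sup>2)"
      by auto
  qed
  have moment: "(\<integral>\<omega>. X \<omega> $ i * X \<omega> $ k \<partial>M) = (if i = k then 1 else 0)" if "i < n" "k < n" for i k
    using arg_cong[OF cov, of "\<lambda>A. A $$ (i, k)"] that by (simp add: cov_mat_def mean)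
  have expand: "((transpose_mat r *\<^sub>v X \<omega>) $ j)\<^sup>2
      = (\<Sum>i<n. \<Sum>k<n. r $$ (i, j) * r $$ (k, j) * (X \<omega> $ i * X \<omega> $ k))" if "\<omega> \<in> space M" for \<omega>
  proof -
    have "X \<omega> \<in> carrier_vec n"
      using measurable_space[OF X that] by (simp add: space_lborel_vec)
    then have "(transpose_mat r *\<^sub>v X \<omega>) $ j = (\<Sum>i<n. r $$ (i, j) * X \<omega> $ i)"
      using mult_mat_vec_index_sum[of "transpose_mat r" l n "X \<omega>" j] rc j by simp
    then show ?thesis
      by (simp add: power2_eq_square sum_product mult_ac)
  qed
  have "has_bochner_integral M (\<lambda>\<omega>. \<Sum>i<n. \<Sum>k<n. r $$ (i, j) * r $$ (k, j) * (X \<omega> $ i * X \<omega> $ k))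
      (\<Sum>i<n. \<Sum>k<n. r $$ (i, j) * r $$ (k, j) * (if i = k then 1 else 0))"
    using int moment
    by (intro has_bochner_integral_sum has_bochner_integral_mult_right) (simp add: has_bochner_integral_iff)
  then have int': "integrable M (\<lambda>\<omega>. \<Sum>i<n. \<Sum>k<n. r $$ (i, j) * r $$ (k, j) * (X \<omega> $ i * X \<omega> $ k))"
    and int_eq: "(\<integral>\<omega>. (\<Sum>i<n. \<Sum>k<n. r $$ (i, j) * r $$ (k, j) * (X \<omega> $ i * X \<omega> $ k)) \<partial>M)
      = (\<Sum>i<n. \<Sum>k<n. r $$ (i, j) * r $$ (k, j) * (if i = k then 1 else 0))"
    by (simp_all add: has_bochner_integral_iff)
  have "(\<integral>\<^sup>+ \<omega>. ennreal (((transpose_mat r *\<^sub>v X \<omega>) $ j)\<^sup>2) \<partial>M)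
      = (\<integral>\<^sup>+ \<omega>. ennreal (\<Sum>i<n. \<Sum>k<n. r $$ (i, j) * r $$ (k, j) * (X \<omega> $ i * X \<omega> $ k)) \<partial>M)"
    by (rule nn_integral_cong) (simp add: expand)
  also have "\<dots> = ennreal (\<integral>\<omega>. (\<Sum>i<n. \<Sum>k<n. r $$ (i, j) * r $$ (k, j) * (X \<omega> $ i * X \<omega> $ k)) \<partial>M)"
    by (rule nn_integral_eq_integral[OF int']) (auto simp flip: expand)
  also have "(\<integral>\<omega>. (\<Sum>i<n. \<Sum>k<n. r $$ (i, j) * r $$ (k, j) * (X \<omega> $ i * X \<omega> $ k)) \<partial>M)
      = (\<Sum>i<n. \<Sum>k<n. r $$ (i, j) * r $$ (k, j) * (if i = k then 1 else 0))"
    by (rule int_eq)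
  also have "\<dots> = (\<Sum>i<n. r $$ (i, j) * r $$ (i, j))"
    by (rule sum.cong) (simp_all add: if_distrib[of "(*) _"] cong: if_cong)
  also have "\<dots> = (transpose_mat r * r) $$ (j, j)"
    using rc j by (auto simp: scalar_prod_def lessThan_atLeast0 intro!: sum.cong)
  also have "\<dots> = 1"
    using j by (simp add: rr)
  finally show ?thesis by simp
qed

lemma team_loss_observed:
  assumes Q: "sym_pos_def m Q" and S: "S \<in> carrier_mat m l" and r: "r \<in> carrier_mat n l"
    and u: "u \<in> carrier_vec m" and x: "x \<in> carrier_vec n"
  shows "team_loss Q (S * transpose_mat r) u x = team_loss Q S u (transpose_mat r *\<^sub>v x)"
proof -
  have rt: "transpose_mat r \<in> carrier_mat l n"
    using r by auto
  note B = sym_pos_def_inverse(1)[OF Q]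
  have "(the (mat_inverse Q) * (S * transpose_mat r)) *\<^sub>v x
      = (the (mat_inverse Q) * S) *\<^sub>v (transpose_mat r *\<^sub>v x)"
    using assoc_mult_mat[OF B S rt] assoc_mult_mat_vec[of "the (mat_inverse Q) * S" m l "transpose_mat r" n x]
      B S rt x by simp
  moreover have "S * transpose_mat r \<in> carrier_mat m n" "transpose_mat r *\<^sub>v x \<in> carrier_vec l"
    using S rt x by auto
  ultimately show ?thesis
    using u x by (simp add: team_loss_eq_quad_form[OF Q S] team_loss_eq_quad_form[OF Q, of _ n])
qed

definition profile_loss :: "real mat \<Rightarrow> real mat \<Rightarrow> (nat \<Rightarrow> real mat) \<Rightarrow> (nat \<Rightarrow> real vec \<Rightarrow> real)
    \<Rightarrow> real vec \<Rightarrow> real" where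
  "profile_loss Q S H \<gamma> y = team_loss Q S (vec (dim_row Q) (\<lambda>i. \<gamma> i (H i *\<^sub>v y))) y"

lemma borel_measurable_profile_loss:
  assumes Q: "sym_pos_def m Q" and S: "S \<in> carrier_mat m l"
    and H: "\<And>i. i < m \<Longrightarrow> H i \<in> carrier_mat (d i) l" and \<gamma>: "admissible Q H \<gamma>"
  shows "profile_loss Q S H \<gamma> \<in> borel_measurable (lborel_vec l)"
proof -
  have dim: "dim_row Q = m"
    using Q by (auto simp: sym_pos_def_def)
  obtain P :: "real mat" where P: "\<And>u y. y \<in> carrier_vec l \<Longrightarrow>
    team_loss Q S (vec m u) y = 1/2 * (\<Sum>i<m. \<Sum>j<m. Q $$ (i, j) *
      ((u i + (\<Sum>k<l. P $$ (i, k) * y $ k)) * (u j + (\<Sum>k<l. P $$ (j, k) * y $ k))))"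
    using team_loss_coord[OF Q S] by blast
  have g: "(\<lambda>y. \<gamma> i (H i *\<^sub>v y)) \<in> borel_measurable (lborel_vec l)" if "i < m" for i
    using \<gamma> H[OF that] that
    by (intro measurable_compose[OF measurable_mult_mat_vec[OF H[OF that]]]) (auto simp: admissible_def dim)
  have "(\<lambda>y. 1/2 * (\<Sum>i<m. \<Sum>j<m. Q $$ (i, j) *
      ((\<gamma> i (H i *\<^sub>v y) + (\<Sum>k<l. P $$ (i, k) * y $ k)) * (\<gamma> j (H j *\<^sub>v y) + (\<Sum>k<l. P $$ (j, k) * y $ k)))))
      \<in> borel_measurable (lborel_vec l)"
    by (intro borel_measurable_times borel_measurable_sum borel_measurable_add borel_measurable_const g
        measurable_vec_index) auto
  then show ?thesis
    by (rule measurable_cong[THEN iffD1, rotated]) (simp add: profile_loss_def dim P space_lborel_vec)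
qed

text \<open>The state enters both the loss and the observations only through \<open>r\<^sup>T X\<close>, so each problem of the
  ensemble is the same problem under a different law on a space of fixed dimension.\<close>

lemma team_cost_observed:
  assumes Q: "sym_pos_def m Q" and S: "S \<in> carrier_mat m l"
    and H: "\<And>i. i < m \<Longrightarrow> H i \<in> carrier_mat (d i) l"
    and r: "r \<in> carrier_mat n l" and X: "X \<in> measurable M (lborel_vec n)"
    and f: "distributed (distr M (lborel_vec n) X) (lborel_vec l) (\<lambda>x. transpose_mat r *\<^sub>v x) (\<lambda>x. ennreal (f x))"
    and \<gamma>: "admissible Q H \<gamma>"
  shows "team_cost Q (S * transpose_mat r) (\<lambda>i. H i * transpose_mat r) M X \<gamma>
    = (\<integral>\<^sup>+ y. ennreal (profile_loss Q S H \<gamma> y) * ennreal (f y) \<partial>lborel_vec l)"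
proof -
  have dim: "dim_row Q = m"
    using Q by (auto simp: sym_pos_def_def)
  have rt: "transpose_mat r \<in> carrier_mat l n"
    using r by auto
  note R = measurable_mult_mat_vec[OF rt]
  have L: "profile_loss Q S H \<gamma> \<in> borel_measurable (lborel_vec l)"
    by (rule borel_measurable_profile_loss[OF Q S H \<gamma>])
  have "team_loss Q (S * transpose_mat r) (vec m (\<lambda>i. \<gamma> i ((H i * transpose_mat r) *\<^sub>v x))) x
      = profile_loss Q S H \<gamma> (transpose_mat r *\<^sub>v x)" if x: "x \<in> carrier_vec n" for x
  proof -
    have "vec m (\<lambda>i. \<gamma> i ((H i * transpose_mat r) *\<^sub>v x)) = vec m (\<lambda>i. \<gamma> i (H i *\<^sub>v (transpose_mat r *\<^sub>v x)))"
      using assoc_mult_mat_vec[OF H rt x] by (intro eq_vecI) auto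
    then show ?thesis
      by (simp add: profile_loss_def dim team_loss_observed[OF Q S r _ x])
  qed
  then have "team_cost Q (S * transpose_mat r) (\<lambda>i. H i * transpose_mat r) M X \<gamma>
      = (\<integral>\<^sup>+ \<omega>. ennreal (profile_loss Q S H \<gamma> (transpose_mat r *\<^sub>v X \<omega>)) \<partial>M)"
    unfolding team_cost_def using measurable_space[OF X]
    by (intro nn_integral_cong) (auto simp: dim space_lborel_vec)
  also have "\<dots> = (\<integral>\<^sup>+ x. ennreal (profile_loss Q S H \<gamma> (transpose_mat r *\<^sub>v x)) \<partial>distr M (lborel_vec n) X)"
    using measurable_compose[OF R L] by (intro nn_integral_distr[symmetric] X) measurable
  also have "\<dots> = (\<integral>\<^sup>+ y. ennreal (f y) * ennreal (profile_loss Q S H \<gamma> y) \<partial>lborel_vec l)"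
    using L by (intro distributed_nn_integral[OF f, symmetric]) measurable
  finally show ?thesis
    by (simp add: mult.commute)
qed

lemma projected_density_moments:
  assumes M: "prob_space M" and iso: "isotropic n M X" and r: "r \<in> stiefel n l"
    and f: "distributed (distr M (lborel_vec n) X) (lborel_vec l) (\<lambda>x. transpose_mat r *\<^sub>v x) (\<lambda>x. ennreal (f x))"
  shows "(\<integral>\<^sup>+ y. ennreal (f y) \<partial>lborel_vec l) = 1"
    and "(\<integral>\<^sup>+ y. ennreal (\<Sum>j<l. (y $ j)\<^sup>2) * ennreal (f y) \<partial>lborel_vec l) = ennreal (real l)"
proof -
  interpret M: prob_space M by fact
  have X: "X \<in> measurable M (lborel_vec n)"
    using iso by (auto simp: isotropic_def)
  have rt: "transpose_mat r \<in> carrier_mat l n"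
    using r by (auto simp: stiefel_def)
  note R = measurable_mult_mat_vec[OF rt]
  have conv: "(\<integral>\<^sup>+ y. g y * ennreal (f y) \<partial>lborel_vec l) = (\<integral>\<^sup>+ \<omega>. g (transpose_mat r *\<^sub>v X \<omega>) \<partial>M)"
    if g: "g \<in> borel_measurable (lborel_vec l)" for g :: "real vec \<Rightarrow> ennreal"
  proof -
    have "(\<integral>\<^sup>+ y. g y * ennreal (f y) \<partial>lborel_vec l)
        = (\<integral>\<^sup>+ x. g (transpose_mat r *\<^sub>v x) \<partial>distr M (lborel_vec n) X)"
      using distributed_nn_integral[OF f g] by (simp add: mult.commute)
    also have "\<dots> = (\<integral>\<^sup>+ \<omega>. g (transpose_mat r *\<^sub>v X \<omega>) \<partial>M)"
      using measurable_compose[OF R g] by (intro nn_integral_distr X) measurable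
    finally show ?thesis .
  qed
  show "(\<integral>\<^sup>+ y. ennreal (f y) \<partial>lborel_vec l) = 1"
    using conv[of "\<lambda>_. 1"] by (simp add: M.emeasure_space_1)
  have h: "(\<lambda>y. ennreal (\<Sum>j<l. (y $ j)\<^sup>2)) \<in> borel_measurable (lborel_vec l)"
    by (intro measurable_compose[OF _ measurable_ennreal] borel_measurable_sum borel_measurable_power) (auto intro: measurable_vec_index)
  have mj: "(\<lambda>\<omega>. (transpose_mat r *\<^sub>v X \<omega>) $ j) \<in> borel_measurable M" if "j < l" for j
    using measurable_compose[OF measurable_compose[OF X R] measurable_vec_index[OF that]] .
  have "(\<integral>\<^sup>+ y. ennreal (\<Sum>j<l. (y $ j)\<^sup>2) * ennreal (f y) \<partial>lborel_vec l)
      = (\<integral>\<^sup>+ \<omega>. (\<Sum>j<l. ennreal (((transpose_mat r *\<^sub>v X \<omega>) $ j)\<^sup>2)) \<partial>M)"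
    by (simp add: conv[OF h] sum_ennreal)
  also have "\<dots> = (\<Sum>j<l. \<integral>\<^sup>+ \<omega>. ennreal (((transpose_mat r *\<^sub>v X \<omega>) $ j)\<^sup>2) \<partial>M)"
    by (rule nn_integral_sum) (use mj in measurable)
  also have "\<dots> = (\<Sum>j<l. 1)"
    using nn_integral_isotropic_projection[OF iso r] by (intro sum.cong) auto
  finally show "(\<integral>\<^sup>+ y. ennreal (\<Sum>j<l. (y $ j)\<^sup>2) * ennreal (f y) \<partial>lborel_vec l) = ennreal (real l)"
    by (simp add: ennreal_of_nat_eq_real_of_nat)
qed

lemma gauss_moment:
  "(\<integral>\<^sup>+ y. ennreal (\<Sum>j<l. (y $ j)\<^sup>2) * ennreal (std_normal_vec l y) \<partial>lborel_vec l) = ennreal (real l)"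
proof -
  have "(\<integral>\<^sup>+ y. ennreal (\<Sum>j<l. (y $ j)\<^sup>2) * ennreal (std_normal_vec l y) \<partial>lborel_vec l)
      = (\<integral>\<^sup>+ y. (\<Sum>j<l. ennreal (std_normal_vec l y) * ennreal ((y $ j)\<^sup>2)) \<partial>lborel_vec l)"
    by (simp add: sum_distrib_left mult.commute flip: sum_ennreal)
  also have "\<dots> = (\<Sum>j<l. \<integral>\<^sup>+ y. ennreal (std_normal_vec l y) * ennreal ((y $ j)\<^sup>2) \<partial>lborel_vec l)"
    by (rule nn_integral_sum) measurable
  also have "\<dots> = (\<Sum>j<l. 1)"
    by (intro sum.cong) (auto simp: nn_integral_std_normal_vec_square)
  finally show ?thesis
    by (simp add: ennreal_of_nat_eq_real_of_nat)
qed

section \<open>Limits of minimizers\<close>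

definition team_risk :: "real mat \<Rightarrow> real mat \<Rightarrow> (nat \<Rightarrow> real mat) \<Rightarrow> nat \<Rightarrow> (real vec \<Rightarrow> real)
    \<Rightarrow> (nat \<Rightarrow> real vec \<Rightarrow> real) \<Rightarrow> ennreal" where
  "team_risk Q S H l f \<gamma> =
     (\<integral>\<^sup>+ y. ennreal (profile_loss Q S H \<gamma> y) * ennreal (f y) \<partial>lborel_vec l)"

text \<open>The fixed-dimensional problem. Surjectivity of the observation maps \<open>H i\<close> is what lets statements
  about almost all observations and about almost all states be exchanged.\<close>

locale team_problem =
  fixes Q S :: "real mat" and H :: "nat \<Rightarrow> real mat" and m l :: nat and d :: "nat \<Rightarrow> nat"
  assumes Q: "sym_pos_def m Q" and S: "S \<in> carrier_mat m l"
    and H: "\<And>i. i < m \<Longrightarrow> H i \<in> carrier_mat (d i) l"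
    and H_surj: "\<And>i z. i < m \<Longrightarrow> z \<in> carrier_vec (d i) \<Longrightarrow> \<exists>x\<in>carrier_vec l. H i *\<^sub>v x = z"
begin

abbreviation "loss \<equiv> profile_loss Q S H"
abbreviation "risk \<equiv> team_risk Q S H l"
abbreviation "sqnorm y \<equiv> \<Sum>j<l. (y $ j)\<^sup>2"
abbreviation "\<phi> \<equiv> std_normal_vec l"

lemma dim_Q [simp]: "dim_row Q = m"
  using Q by (auto simp: sym_pos_def_def)

lemma admissible_iff: "admissible Q H \<gamma> \<longleftrightarrow> (\<forall>i<m. \<gamma> i \<in> borel_measurable (lborel_vec (d i)))"
proof -
  have "dim_row (H i) = d i" if "i < m" for i
    using H[OF that] by auto
  then show ?thesis
    by (auto simp: admissible_def)
qed

lemma borel_measurable_loss: "admissible Q H \<gamma> \<Longrightarrow> loss \<gamma> \<in> borel_measurable (lborel_vec l)"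
  by (rule borel_measurable_profile_loss[OF Q S H])

lemma loss_nonneg: "y \<in> carrier_vec l \<Longrightarrow> 0 \<le> loss \<gamma> y"
  unfolding profile_loss_def by (intro team_loss_nonneg[OF Q S]) auto

lemma borel_measurable_sqnorm: "(\<lambda>y. sqnorm y) \<in> borel_measurable (lborel_vec l)"
  by (intro borel_measurable_sum borel_measurable_power) (auto intro: measurable_vec_index)

lemma AE_observation:
  assumes i: "i < m" and P: "AE z in lborel_vec (d i). P z"
  shows "AE y in lborel_vec l. P (H i *\<^sub>v y)"
proof -
  obtain N where N: "{z \<in> space (lborel_vec (d i)). \<not> P z} \<subseteq> N"
    "emeasure (lborel_vec (d i)) N = 0" "N \<in> sets (lborel_vec (d i))"
    using P by (rule AE_E)
  have eq: "{z \<in> space (lborel_vec (d i)). z \<notin> N} = space (lborel_vec (d i)) - N"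
    by auto
  have "AE z in lborel_vec (d i). z \<notin> N"
    using N by (auto intro!: AE_not_in simp: null_sets_def)
  then have "AE y in lborel_vec l. H i *\<^sub>v y \<notin> N"
    using N(3) by (subst AE_lborel_vec_surj_iff[OF H[OF i] H_surj[OF i]]) (auto simp: eq)
  then show ?thesis
  proof (rule AE_mp, intro AE_I2 impI)
    fix y assume "y \<in> space (lborel_vec l)" and y: "H i *\<^sub>v y \<notin> N"
    then have "H i *\<^sub>v y \<in> space (lborel_vec (d i))"
      using H[OF i] by (auto simp: space_lborel_vec)
    then show "P (H i *\<^sub>v y)"
      using N(1) y by auto
  qed
qed

lemma loss_tendsto:
  assumes "\<And>i. i < m \<Longrightarrow> (\<lambda>n. g n i (H i *\<^sub>v y)) \<longlonglongrightarrow> g0 i (H i *\<^sub>v y)" and y: "y \<in> carrier_vec l"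
  shows "(\<lambda>n. loss (g n) y) \<longlonglongrightarrow> loss g0 y"
proof -
  obtain P :: "real mat" where P: "\<And>u y. y \<in> carrier_vec l \<Longrightarrow>
    team_loss Q S (vec m u) y = 1/2 * (\<Sum>i<m. \<Sum>j<m. Q $$ (i, j) *
      ((u i + (\<Sum>k<l. P $$ (i, k) * y $ k)) * (u j + (\<Sum>k<l. P $$ (j, k) * y $ k))))"
    using team_loss_coord[OF Q S] by blast
  show ?thesis
    unfolding profile_loss_def dim_Q P[OF y] by (intro tendsto_intros assms(1)) auto
qed

lemma risk_add:
  assumes "g \<in> borel_measurable (lborel_vec l)" "h \<in> borel_measurable (lborel_vec l)"
    "f \<in> borel_measurable (lborel_vec l)"
    "\<And>y. y \<in> carrier_vec l \<Longrightarrow> 0 \<le> g y" "\<And>y. y \<in> carrier_vec l \<Longrightarrow> 0 \<le> h y"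
  shows "(\<integral>\<^sup>+ y. ennreal (g y + h y) * ennreal (f y) \<partial>lborel_vec l)
    = (\<integral>\<^sup>+ y. ennreal (g y) * ennreal (f y) \<partial>lborel_vec l) +
      (\<integral>\<^sup>+ y. ennreal (h y) * ennreal (f y) \<partial>lborel_vec l)"
proof -
  note [measurable] = assms(1-3)
  have "(\<integral>\<^sup>+ y. ennreal (g y + h y) * ennreal (f y) \<partial>lborel_vec l)
    = (\<integral>\<^sup>+ y. ennreal (g y) * ennreal (f y) + ennreal (h y) * ennreal (f y) \<partial>lborel_vec l)"
    using assms(4,5) by (intro nn_integral_cong) (simp add: space_lborel_vec distrib_right)
  also have "\<dots> = (\<integral>\<^sup>+ y. ennreal (g y) * ennreal (f y) \<partial>lborel_vec l) +
      (\<integral>\<^sup>+ y. ennreal (h y) * ennreal (f y) \<partial>lborel_vec l)"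
    by (intro nn_integral_add) measurable
  finally show ?thesis .
qed

lemma nn_integral_affine_sqnorm:
  assumes f: "f \<in> borel_measurable (lborel_vec l)"
    and mass: "(\<integral>\<^sup>+ y. ennreal (f y) \<partial>lborel_vec l) = 1"
    and second: "(\<integral>\<^sup>+ y. ennreal (sqnorm y) * ennreal (f y) \<partial>lborel_vec l) = ennreal (real l)"
    and "0 \<le> a" "0 \<le> b"
  shows "(\<integral>\<^sup>+ y. ennreal (a + b * sqnorm y) * ennreal (f y) \<partial>lborel_vec l) = ennreal (a + b * real l)"
proof -
  have "(\<integral>\<^sup>+ y. ennreal (a + b * sqnorm y) * ennreal (f y) \<partial>lborel_vec l)
      = (\<integral>\<^sup>+ y. ennreal a * ennreal (f y) \<partial>lborel_vec l) +
        (\<integral>\<^sup>+ y. ennreal (b * sqnorm y) * ennreal (f y) \<partial>lborel_vec l)"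
    using f borel_measurable_sqnorm assms(4,5) by (intro risk_add) (auto intro!: mult_nonneg_nonneg sum_nonneg)
  also have "(\<integral>\<^sup>+ y. ennreal a * ennreal (f y) \<partial>lborel_vec l) = ennreal a"
    using f by (subst nn_integral_cmult) (auto simp: mass)
  also have "(\<integral>\<^sup>+ y. ennreal (b * sqnorm y) * ennreal (f y) \<partial>lborel_vec l)
      = (\<integral>\<^sup>+ y. ennreal b * (ennreal (sqnorm y) * ennreal (f y)) \<partial>lborel_vec l)"
    using assms(5) by (intro nn_integral_cong) (simp add: ennreal_mult sum_nonneg mult.assoc)
  also have "\<dots> = ennreal b * ennreal (real l)"
    using f borel_measurable_sqnorm by (subst nn_integral_cmult) (auto simp: second)
  finally show ?thesis
    using assms(4,5) by (simp add: ennreal_mult)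
qed

lemma gauss_affine_sqnorm:
  "0 \<le> a \<Longrightarrow> 0 \<le> b \<Longrightarrow>
    (\<integral>\<^sup>+ y. ennreal (a + b * sqnorm y) * ennreal (\<phi> y) \<partial>lborel_vec l) = ennreal (a + b * real l)"
  by (rule nn_integral_affine_sqnorm) (auto simp: nn_integral_std_normal_vec gauss_moment)

text \<open>Let \<open>a + K |y|\<^sup>2\<close> dominate the loss of the bounded profile \<open>\<beta>\<close> and let \<open>G\<close> be the
  difference. Adding \<open>G\<close> to both sides of the optimality inequality turns its right-hand side into the
  expectation of \<open>a + K |y|\<^sup>2\<close>, which has one and the same value for all \<open>f n\<close> and for \<open>\<phi>\<close>. Fatou's
  lemma applied to \<open>(loss (g n) + G) f n\<close> then bounds the limit, and \<open>G\<close> cancels again. In this way the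
  matching second moments take the place of tail estimates.\<close>

lemma limit_risk_le:
  assumes adm: "\<And>n. admissible Q H (g n)" and adm0: "admissible Q H g0" and admb: "admissible Q H \<beta>"
    and f: "\<And>n. f n \<in> borel_measurable (lborel_vec l)" "\<And>n y. 0 \<le> f n y"
    and mass: "\<And>n. (\<integral>\<^sup>+ y. ennreal (f n y) \<partial>lborel_vec l) = 1"
    and second: "\<And>n. (\<integral>\<^sup>+ y. ennreal (sqnorm y) * ennreal (f n y) \<partial>lborel_vec l) = ennreal (real l)"
    and f_lim: "\<And>y. y \<in> carrier_vec l \<Longrightarrow> (\<lambda>n. f n y) \<longlonglongrightarrow> \<phi> y"
    and opt: "\<And>n. risk (f n) (g n) \<le> risk (f n) \<beta>"
    and g_lim: "\<And>i. i < m \<Longrightarrow> AE z in lborel_vec (d i). (\<lambda>n. g n i z) \<longlonglongrightarrow> g0 i z"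
    and bounded: "\<And>i z. i < m \<Longrightarrow> \<bar>\<beta> i z\<bar> \<le> c"
  shows "risk \<phi> g0 \<le> risk \<phi> \<beta>"
proof -
  note [measurable] = borel_measurable_sqnorm f(1) borel_measurable_loss[OF adm]
    borel_measurable_loss[OF adm0] borel_measurable_loss[OF admb]
  obtain K where K: "0 \<le> K" "\<And>u y. u \<in> carrier_vec m \<Longrightarrow> y \<in> carrier_vec l \<Longrightarrow>
    team_loss Q S u y \<le> K * ((\<Sum>i<m. (u $ i)\<^sup>2) + (\<Sum>j<l. (y $ j)\<^sup>2))"
    using team_loss_upper[OF Q S] by blast
  define a where "a = K * (real m * c\<^sup>2)"
  have a: "0 \<le> a"
    using K(1) by (simp add: a_def)
  define G where "G y = a + K * sqnorm y - loss \<beta> y" for y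
  have [measurable]: "G \<in> borel_measurable (lborel_vec l)"
    unfolding G_def by measurable
  have G: "0 \<le> G y" if y: "y \<in> carrier_vec l" for y
  proof -
    have "(\<beta> i (H i *\<^sub>v y))\<^sup>2 \<le> c\<^sup>2" if "i < m" for i
      using power_mono[OF bounded[OF that, of "H i *\<^sub>v y"], of 2] by simp
    then have "(\<Sum>i<m. (\<beta> i (H i *\<^sub>v y))\<^sup>2) \<le> (\<Sum>i<m. c\<^sup>2)"
      by (intro sum_mono) auto
    then have "(\<Sum>i<m. (\<beta> i (H i *\<^sub>v y))\<^sup>2) + sqnorm y \<le> real m * c\<^sup>2 + sqnorm y"
      by simp
    from mult_left_mono[OF this K(1)]
    have "K * ((\<Sum>i<m. (\<beta> i (H i *\<^sub>v y))\<^sup>2) + sqnorm y) \<le> a + K * sqnorm y"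
      by (simp only: a_def distrib_left)
    then show ?thesis
      using K(2)[OF _ y, of "vec m (\<lambda>i. \<beta> i (H i *\<^sub>v y))"] by (simp add: G_def profile_loss_def)
  qed
  let ?\<Lambda> = "ennreal (a + K * real l)"
  have upper: "(\<integral>\<^sup>+ y. ennreal (loss (g n) y + G y) * ennreal (f n y) \<partial>lborel_vec l) \<le> ?\<Lambda>" for n
  proof -
    have "(\<integral>\<^sup>+ y. ennreal (loss (g n) y + G y) * ennreal (f n y) \<partial>lborel_vec l)
        = risk (f n) (g n) + (\<integral>\<^sup>+ y. ennreal (G y) * ennreal (f n y) \<partial>lborel_vec l)"
      unfolding team_risk_def using loss_nonneg G by (intro risk_add) measurable
    also have "\<dots> \<le> risk (f n) \<beta> + (\<integral>\<^sup>+ y. ennreal (G y) * ennreal (f n y) \<partial>lborel_vec l)"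
      using opt by (rule add_right_mono)
    also have "\<dots> = (\<integral>\<^sup>+ y. ennreal (loss \<beta> y + G y) * ennreal (f n y) \<partial>lborel_vec l)"
      unfolding team_risk_def using loss_nonneg G by (intro risk_add[symmetric]) measurable
    also have "\<dots> = ?\<Lambda>"
      unfolding G_def using nn_integral_affine_sqnorm[OF f(1) mass second a K(1)] by simp
    finally show ?thesis .
  qed
  have "\<forall>i\<in>{..<m}. AE y in lborel_vec l. (\<lambda>n. g n i (H i *\<^sub>v y)) \<longlonglongrightarrow> g0 i (H i *\<^sub>v y)"
    using AE_observation g_lim by auto
  then have "AE y in lborel_vec l. \<forall>i\<in>{..<m}. (\<lambda>n. g n i (H i *\<^sub>v y)) \<longlonglongrightarrow> g0 i (H i *\<^sub>v y)"
    by (subst AE_finite_all) auto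
  then have lim: "AE y in lborel_vec l. ennreal (loss g0 y + G y) * ennreal (\<phi> y)
      = liminf (\<lambda>n. ennreal (loss (g n) y + G y) * ennreal (f n y))"
  proof (rule AE_mp, intro AE_I2 impI)
    fix y assume "y \<in> space (lborel_vec l)"
      and lim: "\<forall>i\<in>{..<m}. (\<lambda>n. g n i (H i *\<^sub>v y)) \<longlonglongrightarrow> g0 i (H i *\<^sub>v y)"
    then have y: "y \<in> carrier_vec l"
      by (simp add: space_lborel_vec)
    have "(\<lambda>n. ennreal ((loss (g n) y + G y) * f n y)) \<longlonglongrightarrow> ennreal ((loss g0 y + G y) * \<phi> y)"
      using lim y f_lim[OF y] by (intro tendsto_ennrealI tendsto_intros loss_tendsto) auto
    then have "(\<lambda>n. ennreal (loss (g n) y + G y) * ennreal (f n y))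
        \<longlonglongrightarrow> ennreal (loss g0 y + G y) * ennreal (\<phi> y)"
      using loss_nonneg[OF y] G[OF y] f(2) std_normal_vec_pos[of l y]
      by (simp add: ennreal_mult less_imp_le)
    then show "ennreal (loss g0 y + G y) * ennreal (\<phi> y)
        = liminf (\<lambda>n. ennreal (loss (g n) y + G y) * ennreal (f n y))"
      by (intro lim_imp_Liminf[symmetric]) auto
  qed
  have "risk \<phi> g0 + (\<integral>\<^sup>+ y. ennreal (G y) * ennreal (\<phi> y) \<partial>lborel_vec l)
      = (\<integral>\<^sup>+ y. ennreal (loss g0 y + G y) * ennreal (\<phi> y) \<partial>lborel_vec l)"
    unfolding team_risk_def using loss_nonneg G by (intro risk_add[symmetric]) measurable
  also have "\<dots> = (\<integral>\<^sup>+ y. liminf (\<lambda>n. ennreal (loss (g n) y + G y) * ennreal (f n y)) \<partial>lborel_vec l)"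
    using lim by (rule nn_integral_cong_AE)
  also have "\<dots> \<le> liminf (\<lambda>n. \<integral>\<^sup>+ y. ennreal (loss (g n) y + G y) * ennreal (f n y) \<partial>lborel_vec l)"
    by (rule nn_integral_liminf) measurable
  also have "\<dots> \<le> liminf (\<lambda>n. ?\<Lambda>)"
    using upper by (intro Liminf_mono) auto
  also have "\<dots> = ?\<Lambda>"
    by (simp add: Liminf_const)
  also have "?\<Lambda> = (\<integral>\<^sup>+ y. ennreal (loss \<beta> y + G y) * ennreal (\<phi> y) \<partial>lborel_vec l)"
    unfolding G_def using gauss_affine_sqnorm[OF a K(1)] by simp
  also have "\<dots> = risk \<phi> \<beta> + (\<integral>\<^sup>+ y. ennreal (G y) * ennreal (\<phi> y) \<partial>lborel_vec l)"
    unfolding team_risk_def using loss_nonneg G by (intro risk_add) measurable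
  finally have le: "risk \<phi> g0 + (\<integral>\<^sup>+ y. ennreal (G y) * ennreal (\<phi> y) \<partial>lborel_vec l)
      \<le> risk \<phi> \<beta> + (\<integral>\<^sup>+ y. ennreal (G y) * ennreal (\<phi> y) \<partial>lborel_vec l)" .
  have "(\<integral>\<^sup>+ y. ennreal (G y) * ennreal (\<phi> y) \<partial>lborel_vec l)
      \<le> (\<integral>\<^sup>+ y. ennreal (a + K * sqnorm y) * ennreal (\<phi> y) \<partial>lborel_vec l)"
    using loss_nonneg by (intro nn_integral_mono mult_right_mono ennreal_leI) (auto simp: G_def space_lborel_vec)
  also have "\<dots> < \<top>"
    by (simp add: gauss_affine_sqnorm[OF a K(1)])
  finally show ?thesis
    using le by (auto simp: add.commute[of "team_risk _ _ _ _ _ _"] ennreal_add_left_cancel_le)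
qed

lemma finite_optimal_risk:
  assumes opt: "\<And>\<beta>. admissible Q H \<beta> \<Longrightarrow> risk \<phi> \<gamma> \<le> risk \<phi> \<beta>"
  shows "risk \<phi> \<gamma> < \<top>"
proof -
  obtain K where K: "0 \<le> K" "\<And>u y. u \<in> carrier_vec m \<Longrightarrow> y \<in> carrier_vec l \<Longrightarrow>
    team_loss Q S u y \<le> K * ((\<Sum>i<m. (u $ i)\<^sup>2) + (\<Sum>j<l. (y $ j)\<^sup>2))"
    using team_loss_upper[OF Q S] by blast
  have "risk \<phi> \<gamma> \<le> risk \<phi> (\<lambda>i z. 0)"
    by (rule opt) (simp add: admissible_iff)
  also have "\<dots> \<le> (\<integral>\<^sup>+ y. ennreal (0 + K * sqnorm y) * ennreal (\<phi> y) \<partial>lborel_vec l)"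
    unfolding team_risk_def profile_loss_def
    using K(2)[of "vec m (\<lambda>i. 0)"]
    by (intro nn_integral_mono mult_right_mono ennreal_leI) (auto simp: space_lborel_vec)
  also have "\<dots> < \<top>"
    using gauss_affine_sqnorm[of 0 K] K(1) by simp
  finally show ?thesis .
qed

text \<open>Dominated convergence: truncation shrinks the controls, so the upper bound on the loss together
  with its coercivity dominates the losses of all truncations by one integrable function.\<close>

lemma risk_truncation_tendsto:
  assumes adm: "admissible Q H \<gamma>" and fin: "risk \<phi> \<gamma> < \<top>"
  shows "(\<lambda>k. risk \<phi> (\<lambda>i z. max (- real k) (min (real k) (\<gamma> i z)))) \<longlonglongrightarrow> risk \<phi> \<gamma>"
proof -
  let ?B = "\<lambda>k i z. max (- real k) (min (real k) (\<gamma> i z))"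
  have admB: "admissible Q H (?B k)" for k
    using adm by (auto simp: admissible_iff)
  note [measurable] = borel_measurable_sqnorm borel_measurable_loss[OF adm] borel_measurable_loss[OF admB]
  obtain K where K: "0 \<le> K" "\<And>u y. u \<in> carrier_vec m \<Longrightarrow> y \<in> carrier_vec l \<Longrightarrow>
    team_loss Q S u y \<le> K * ((\<Sum>i<m. (u $ i)\<^sup>2) + (\<Sum>j<l. (y $ j)\<^sup>2))"
    using team_loss_upper[OF Q S] by blast
  obtain L where L: "0 \<le> L" "\<And>u y i. u \<in> carrier_vec m \<Longrightarrow> y \<in> carrier_vec l \<Longrightarrow> i < m \<Longrightarrow>
    (u $ i)\<^sup>2 \<le> L * (team_loss Q S u y + (\<Sum>j<l. (y $ j)\<^sup>2))"
    using team_loss_coercive[OF Q S] by blast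
  define a where "a = K * (real m * L)"
  define b where "b = a + K"
  have a: "0 \<le> a" and b: "0 \<le> b"
    using K(1) L(1) by (auto simp: a_def b_def)
  have dom: "loss (?B k) y \<le> a * loss \<gamma> y + (0 + b * sqnorm y)" if y: "y \<in> carrier_vec l" for k y
  proof -
    have "(?B k i (H i *\<^sub>v y))\<^sup>2 \<le> L * (loss \<gamma> y + sqnorm y)" if "i < m" for i
    proof -
      have "\<bar>?B k i (H i *\<^sub>v y)\<bar> \<le> \<bar>\<gamma> i (H i *\<^sub>v y)\<bar>"
        by linarith
      then have "(?B k i (H i *\<^sub>v y))\<^sup>2 \<le> (\<gamma> i (H i *\<^sub>v y))\<^sup>2"
        by (simp only: abs_le_square_iff)
      also have "\<dots> \<le> L * (loss \<gamma> y + sqnorm y)"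
        using L(2)[OF _ y that, of "vec m (\<lambda>i. \<gamma> i (H i *\<^sub>v y))"] that by (simp add: profile_loss_def)
      finally show ?thesis .
    qed
    then have "(\<Sum>i<m. (?B k i (H i *\<^sub>v y))\<^sup>2) \<le> (\<Sum>i<m. L * (loss \<gamma> y + sqnorm y))"
      by (intro sum_mono) auto
    then have "K * ((\<Sum>i<m. (?B k i (H i *\<^sub>v y))\<^sup>2) + sqnorm y)
        \<le> K * (real m * (L * (loss \<gamma> y + sqnorm y)) + sqnorm y)"
      using K(1) by (intro mult_left_mono) auto
    also have "\<dots> = a * loss \<gamma> y + (0 + b * sqnorm y)"
      by (simp add: a_def b_def algebra_simps)
    finally show ?thesis
      using K(2)[OF _ y, of "vec m (\<lambda>i. ?B k i (H i *\<^sub>v y))"] by (simp add: profile_loss_def)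
  qed
  let ?w = "\<lambda>y. ennreal (a * loss \<gamma> y + (0 + b * sqnorm y)) * ennreal (\<phi> y)"
  have "(\<integral>\<^sup>+ y. ?w y \<partial>lborel_vec l)
      = (\<integral>\<^sup>+ y. ennreal (a * loss \<gamma> y) * ennreal (\<phi> y) \<partial>lborel_vec l) +
        (\<integral>\<^sup>+ y. ennreal (0 + b * sqnorm y) * ennreal (\<phi> y) \<partial>lborel_vec l)"
    using loss_nonneg a b by (intro risk_add) (auto intro!: mult_nonneg_nonneg sum_nonneg)
  also have "(\<integral>\<^sup>+ y. ennreal (a * loss \<gamma> y) * ennreal (\<phi> y) \<partial>lborel_vec l)
      = (\<integral>\<^sup>+ y. ennreal a * (ennreal (loss \<gamma> y) * ennreal (\<phi> y)) \<partial>lborel_vec l)"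
    using a loss_nonneg by (intro nn_integral_cong) (simp add: ennreal_mult mult.assoc space_lborel_vec)
  also have "\<dots> = ennreal a * risk \<phi> \<gamma>"
    unfolding team_risk_def by (rule nn_integral_cmult) measurable
  finally have w: "(\<integral>\<^sup>+ y. ?w y \<partial>lborel_vec l) < \<top>"
    using fin by (simp only: gauss_affine_sqnorm[OF order_refl b] ennreal_add_less_top) (simp add: ennreal_mult_less_top)
  show ?thesis
    unfolding team_risk_def
  proof (rule nn_integral_dominated_convergence[where w = ?w])
    show "AE y in lborel_vec l. ennreal (loss (?B k) y) * ennreal (\<phi> y) \<le> ?w y" for k
      using dom by (intro AE_I2 mult_right_mono ennreal_leI) (auto simp: space_lborel_vec)
    show "AE y in lborel_vec l. (\<lambda>k. ennreal (loss (?B k) y) * ennreal (\<phi> y))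
        \<longlonglongrightarrow> ennreal (loss \<gamma> y) * ennreal (\<phi> y)"
    proof (intro AE_I2)
      fix y assume "y \<in> space (lborel_vec l)"
      then have y: "y \<in> carrier_vec l"
        by (simp add: space_lborel_vec)
      have "(\<lambda>k. ?B k i (H i *\<^sub>v y)) \<longlonglongrightarrow> \<gamma> i (H i *\<^sub>v y)" for i
      proof (rule tendsto_eventually)
        obtain N :: nat where "\<bar>\<gamma> i (H i *\<^sub>v y)\<bar> \<le> real N"
          using real_arch_simple by blast
        then show "\<forall>\<^sub>F k in sequentially. ?B k i (H i *\<^sub>v y) = \<gamma> i (H i *\<^sub>v y)"
          by (intro eventually_sequentiallyI[of N]) (auto simp: abs_le_iff max_def min_def)
      qed
      then have "(\<lambda>k. loss (?B k) y) \<longlonglongrightarrow> loss \<gamma> y"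
        using y by (rule loss_tendsto)
      then have "(\<lambda>k. ennreal (loss (?B k) y * \<phi> y)) \<longlonglongrightarrow> ennreal (loss \<gamma> y * \<phi> y)"
        by (intro tendsto_ennrealI tendsto_intros)
      then show "(\<lambda>k. ennreal (loss (?B k) y) * ennreal (\<phi> y)) \<longlonglongrightarrow> ennreal (loss \<gamma> y) * ennreal (\<phi> y)"
        using loss_nonneg[OF y] std_normal_vec_pos[of l y] by (simp add: ennreal_mult less_imp_le)
    qed
    show "(\<integral>\<^sup>+ y. ?w y \<partial>lborel_vec l) < \<infinity>"
      using w by (simp only: infinity_ennreal_def)
  qed measurable
qed

text \<open>Otherwise the midpoint of the two profiles would have strictly smaller risk. The comparison takes
  place on the state space and is carried over to the observations by surjectivity.\<close>

lemma gauss_minimizer_unique: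
  assumes adm: "admissible Q H \<gamma>" "admissible Q H \<gamma>'"
    and opt: "\<And>\<beta>. admissible Q H \<beta> \<Longrightarrow> risk \<phi> \<gamma> \<le> risk \<phi> \<beta>"
    and le: "risk \<phi> \<gamma>' \<le> risk \<phi> \<gamma>" and i: "i < m"
  shows "AE z in lborel_vec (d i). \<gamma>' i z = \<gamma> i z"
proof -
  define \<mu> where "\<mu> = (\<lambda>i z. 1/2 * (\<gamma> i z + \<gamma>' i z))"
  have adm\<mu>: "admissible Q H \<mu>"
    using adm unfolding admissible_iff \<mu>_def
    by (intro allI impI borel_measurable_times borel_measurable_add borel_measurable_const) auto
  note [measurable] = borel_measurable_loss[OF adm(1)] borel_measurable_loss[OF adm(2)] borel_measurable_loss[OF adm\<mu>]
  obtain K where K: "0 < K" "\<And>u u' y i. u \<in> carrier_vec m \<Longrightarrow> u' \<in> carrier_vec m \<Longrightarrow> y \<in> carrier_vec l \<Longrightarrow> i < m \<Longrightarrow>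
    (u $ i - u' $ i)\<^sup>2 + K * team_loss Q S ((1/2) \<cdot>\<^sub>v (u + u')) y
      \<le> K/2 * (team_loss Q S u y + team_loss Q S u' y)"
    using team_loss_midpoint[OF Q S] by blast
  let ?s = "\<lambda>y. (\<gamma> i (H i *\<^sub>v y) - \<gamma>' i (H i *\<^sub>v y))\<^sup>2"
  have [measurable]: "(\<lambda>y. \<gamma> i (H i *\<^sub>v y)) \<in> borel_measurable (lborel_vec l)"
      "(\<lambda>y. \<gamma>' i (H i *\<^sub>v y)) \<in> borel_measurable (lborel_vec l)"
    using adm i unfolding admissible_iff
    by (auto intro!: measurable_compose[OF measurable_mult_mat_vec[OF H[OF i]]])
  have mid: "?s y + K * loss \<mu> y \<le> K/2 * loss \<gamma> y + K/2 * loss \<gamma>' y" if y: "y \<in> carrier_vec l" for y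
  proof -
    have "vec m (\<lambda>i. \<mu> i (H i *\<^sub>v y)) = (1/2) \<cdot>\<^sub>v (vec m (\<lambda>i. \<gamma> i (H i *\<^sub>v y)) + vec m (\<lambda>i. \<gamma>' i (H i *\<^sub>v y)))"
      by (intro eq_vecI) (auto simp: \<mu>_def)
    then show ?thesis
      using K(2)[of "vec m (\<lambda>i. \<gamma> i (H i *\<^sub>v y))" "vec m (\<lambda>i. \<gamma>' i (H i *\<^sub>v y))" y i] y i
      by (simp add: profile_loss_def distrib_left)
  qed
  have scale: "(\<integral>\<^sup>+ y. ennreal (c * loss \<beta> y) * ennreal (\<phi> y) \<partial>lborel_vec l) = ennreal c * risk \<phi> \<beta>"
    if "0 \<le> c" "admissible Q H \<beta>" for c \<beta>
  proof -
    have "(\<integral>\<^sup>+ y. ennreal (c * loss \<beta> y) * ennreal (\<phi> y) \<partial>lborel_vec l)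
        = (\<integral>\<^sup>+ y. ennreal c * (ennreal (loss \<beta> y) * ennreal (\<phi> y)) \<partial>lborel_vec l)"
      using that(1) loss_nonneg by (intro nn_integral_cong) (simp add: ennreal_mult mult.assoc space_lborel_vec)
    then show ?thesis
      using borel_measurable_loss[OF that(2)] unfolding team_risk_def by (simp add: nn_integral_cmult)
  qed
  let ?D = "\<integral>\<^sup>+ y. ennreal (?s y) * ennreal (\<phi> y) \<partial>lborel_vec l"
  have fin: "risk \<phi> \<gamma> < \<top>"
    by (rule finite_optimal_risk[OF opt])
  have "?D + ennreal K * risk \<phi> \<mu> = (\<integral>\<^sup>+ y. ennreal (?s y + K * loss \<mu> y) * ennreal (\<phi> y) \<partial>lborel_vec l)"
    using K(1) loss_nonneg
    by (simp only: scale[OF less_imp_le[OF K(1)] adm\<mu>, symmetric]) (intro risk_add[symmetric], auto)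
  also have "\<dots> \<le> (\<integral>\<^sup>+ y. ennreal (K/2 * loss \<gamma> y + K/2 * loss \<gamma>' y) * ennreal (\<phi> y) \<partial>lborel_vec l)"
    using mid by (intro nn_integral_mono mult_right_mono ennreal_leI) (auto simp: space_lborel_vec)
  also have "\<dots> = ennreal (K/2) * risk \<phi> \<gamma> + ennreal (K/2) * risk \<phi> \<gamma>'"
  proof -
    have "0 \<le> K/2"
      using K(1) by simp
    with loss_nonneg show ?thesis
      unfolding scale[OF \<open>0 \<le> K/2\<close> adm(1), symmetric] scale[OF \<open>0 \<le> K/2\<close> adm(2), symmetric]
      by (intro risk_add mult_nonneg_nonneg) measurable
  qed
  also have "\<dots> \<le> ennreal (K/2) * risk \<phi> \<gamma> + ennreal (K/2) * risk \<phi> \<gamma>"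
    by (intro add_left_mono mult_left_mono le) auto
  also have "\<dots> = ennreal K * risk \<phi> \<gamma>"
    using K(1) by (simp flip: distrib_right ennreal_plus)
  finally have key: "?D + ennreal K * risk \<phi> \<mu> \<le> ennreal K * risk \<phi> \<gamma>" .
  also have "\<dots> \<le> ennreal K * risk \<phi> \<mu>"
    by (intro mult_left_mono opt adm\<mu>) auto
  finally have "?D + ennreal K * risk \<phi> \<mu> \<le> 0 + ennreal K * risk \<phi> \<mu>"
    by simp
  moreover have "ennreal K * risk \<phi> \<mu> < \<top>"
  proof -
    have "ennreal K * risk \<phi> \<mu> \<le> ennreal K * risk \<phi> \<gamma>"
      by (rule order_trans[OF _ key]) (simp add: add_increasing)
    also have "\<dots> < \<top>"
      using fin by (simp add: ennreal_mult_less_top)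
    finally show ?thesis .
  qed
  ultimately have "?D = 0"
    by (auto simp: add.commute[of ?D] ennreal_add_left_cancel_le[where c = 0, simplified])
  then have "AE y in lborel_vec l. ennreal (?s y) * ennreal (\<phi> y) = 0"
    by (subst (asm) nn_integral_0_iff_AE) measurable
  then have "AE y in lborel_vec l. \<gamma>' i (H i *\<^sub>v y) = \<gamma> i (H i *\<^sub>v y)"
  proof (rule AE_mp, intro AE_I2 impI)
    fix y assume "ennreal (?s y) * ennreal (\<phi> y) = 0"
    then have "?s y \<le> 0"
      using std_normal_vec_pos[of l y] by (simp add: ennreal_eq_0_iff not_le)
    then show "\<gamma>' i (H i *\<^sub>v y) = \<gamma> i (H i *\<^sub>v y)"
      by simp
  qed
  moreover have "{z \<in> space (lborel_vec (d i)). \<gamma>' i z = \<gamma> i z} \<in> sets (lborel_vec (d i))"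
  proof -
    have [measurable]: "\<gamma> i \<in> borel_measurable (lborel_vec (d i))" "\<gamma>' i \<in> borel_measurable (lborel_vec (d i))"
      using adm i by (auto simp: admissible_iff)
    show ?thesis
      by measurable
  qed
  ultimately show ?thesis
    using iffD1[OF AE_lborel_vec_surj_iff[OF H[OF i] H_surj[OF i], where P = "\<lambda>z. \<gamma>' i z = \<gamma> i z"]]
    by auto
qed

text \<open>Truncations of the Gaussian optimum serve as the bounded competitors; letting the truncation level
  grow shows that the limit profile is optimal for the Gaussian problem, hence equal to \<open>\<gamma>\<close>.\<close>

theorem limit_of_minimizers:
  assumes adm: "\<And>n. admissible Q H (g n)"
    and opt: "\<And>n \<beta>. admissible Q H \<beta> \<Longrightarrow> risk (f n) (g n) \<le> risk (f n) \<beta>"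
    and f: "\<And>n. f n \<in> borel_measurable (lborel_vec l)" "\<And>n y. 0 \<le> f n y"
    and mass: "\<And>n. (\<integral>\<^sup>+ y. ennreal (f n y) \<partial>lborel_vec l) = 1"
    and second: "\<And>n. (\<integral>\<^sup>+ y. ennreal (sqnorm y) * ennreal (f n y) \<partial>lborel_vec l) = ennreal (real l)"
    and f_lim: "\<And>y. y \<in> carrier_vec l \<Longrightarrow> (\<lambda>n. f n y) \<longlonglongrightarrow> \<phi> y"
    and g_lim: "\<And>i. i < m \<Longrightarrow> AE z in lborel_vec (d i). (\<lambda>n. g n i z) \<longlonglongrightarrow> ghat i z"
    and admG: "admissible Q H \<gamma>" and optG: "\<And>\<beta>. admissible Q H \<beta> \<Longrightarrow> risk \<phi> \<gamma> \<le> risk \<phi> \<beta>"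
    and i: "i < m"
  shows "AE z in lborel_vec (d i). ghat i z = \<gamma> i z"
proof -
  \<comment> \<open>a measurable version of \<open>ghat\<close>, which itself need not be measurable\<close>
  define g0 where "g0 i z = lim (\<lambda>n. g n i z)" for i z
  have adm0: "admissible Q H g0"
    using adm unfolding admissible_iff g0_def by (auto intro!: borel_measurable_lim_metric)
  have g0: "AE z in lborel_vec (d i). (\<lambda>n. g n i z) \<longlonglongrightarrow> g0 i z \<and> ghat i z = g0 i z" if "i < m" for i
    using g_lim[OF that]
  proof eventually_elim
    case (elim z)
    from limI[OF elim] have "g0 i z = ghat i z"
      by (simp only: g0_def)
    with elim show ?case
      by (simp only: simp_thms)
  qed
  let ?B = "\<lambda>k i z. max (- real k) (min (real k) (\<gamma> i z))"
  have admB: "admissible Q H (?B k)" for k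
    using admG by (auto simp: admissible_iff)
  have trunc: "risk \<phi> g0 \<le> risk \<phi> (?B k)" for k
  proof (rule limit_risk_le[OF adm adm0 admB f mass second f_lim opt[OF admB]])
    show "AE z in lborel_vec (d i). (\<lambda>n. g n i z) \<longlonglongrightarrow> g0 i z" if "i < m" for i
      using g0[OF that] by eventually_elim blast
    show "\<bar>?B k i z\<bar> \<le> real k" for i z
      by linarith
  qed
  have fin: "risk \<phi> \<gamma> < \<top>"
    by (rule finite_optimal_risk[OF optG])
  have "risk \<phi> g0 \<le> risk \<phi> \<gamma>"
    by (rule LIMSEQ_le_const[OF risk_truncation_tendsto[OF admG fin]]) (intro exI allI impI trunc)
  then have "AE z in lborel_vec (d i). g0 i z = \<gamma> i z"
    by (intro gauss_minimizer_unique[OF admG adm0 optG _ i])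
  with g0[OF i] show ?thesis
    by eventually_elim (elim conjE, simp only:)
qed

end

section \<open>Random projections\<close>

lemma isotropic_distr:
  assumes "isotropic n M X"
  shows "isotropic n (distr M (lborel_vec n) X) (\<lambda>x. x)"
proof -
  have X: "X \<in> measurable M (lborel_vec n)"
    and sq: "\<And>i. i < n \<Longrightarrow> integrable M (\<lambda>\<omega>. (X \<omega> $ i)\<^sup>2)"
    and mean: "mean_vec n M X = 0\<^sub>v n" and cov: "cov_mat n M X = 1\<^sub>m n"
    using assms by (auto simp: isotropic_def)
  let ?\<mu> = "distr M (lborel_vec n) X"
  have mean': "mean_vec n ?\<mu> (\<lambda>x. x) = mean_vec n M X"
    unfolding mean_vec_def by (intro eq_vecI) (auto simp: integral_distr[OF X measurable_vec_index])
  have "cov_mat n ?\<mu> (\<lambda>x. x) = cov_mat n M X"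
  proof (rule eq_matI)
    fix i j assume "i < dim_row (cov_mat n M X)" "j < dim_col (cov_mat n M X)"
    then have ij: "i < n" "j < n"
      by (auto simp: cov_mat_def)
    have "(\<lambda>x. (x $ i - mean_vec n M X $ i) * (x $ j - mean_vec n M X $ j)) \<in> borel_measurable (lborel_vec n)"
      using ij by measurable
    from integral_distr[OF X this] show "cov_mat n ?\<mu> (\<lambda>x. x) $$ (i, j) = cov_mat n M X $$ (i, j)"
      using ij by (simp add: cov_mat_def mean')
  qed (auto simp: cov_mat_def)
  moreover have "integrable ?\<mu> (\<lambda>x. (x $ i)\<^sup>2)" if "i < n" for i
  proof -
    have "(\<lambda>x. (x $ i)\<^sup>2) \<in> borel_measurable (lborel_vec n)"
      using that by measurable
    from integrable_distr_eq[OF X this] show ?thesis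
      using sq[OF that] by simp
  qed
  ultimately show ?thesis
    by (auto simp: isotropic_def mean mean' cov intro!: measurable_ident_sets)
qed

lemma has_log_concave_density_distr:
  assumes "has_log_concave_density n M X"
  shows "has_log_concave_density n (distr M (lborel_vec n) X) (\<lambda>x. x)"
proof -
  obtain f where f: "log_concave n f" "distributed M (lborel_vec n) X (\<lambda>x. ennreal (f x))"
    using assms by (auto simp: has_log_concave_density_def)
  have "distributed (distr M (lborel_vec n) X) (lborel_vec n) (\<lambda>x. x) (\<lambda>x. ennreal (f x))"
    using f(2) by (auto simp: distributed_def distr_id2 intro!: measurable_ident_sets)
  with f(1) show ?thesis
    by (auto simp: has_log_concave_density_def)
qed

lemma seq_law_component:
  assumes R: "\<And>n. n \<in> I \<Longrightarrow> R n \<in> measurable M (borel_mat n k)" and n: "n \<in> I"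
  shows "(\<lambda>r. r n) \<in> measurable (seq_law M I k R) (borel_mat n k)"
    and "distr (seq_law M I k R) (borel_mat n k) (\<lambda>r. r n) = distr M (borel_mat n k) (R n)"
proof -
  have c: "(\<lambda>r. r n) \<in> measurable (\<Pi>\<^sub>M n\<in>I. borel_mat n k) (borel_mat n k)"
    by (rule measurable_component_singleton[OF n])
  then show "(\<lambda>r. r n) \<in> measurable (seq_law M I k R) (borel_mat n k)"
    by (simp add: seq_law_def)
  have "(\<lambda>\<omega>. \<lambda>n\<in>I. R n \<omega>) \<in> measurable M (\<Pi>\<^sub>M n\<in>I. borel_mat n k)"
    using R by (intro measurable_restrict) auto
  from distr_distr[OF c this]
  show "distr (seq_law M I k R) (borel_mat n k) (\<lambda>r. r n) = distr M (borel_mat n k) (R n)"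
    using n by (simp add: seq_law_def comp_def)
qed

lemma prob_space_seq_law:
  assumes "prob_space M" and R: "\<And>n. n \<in> I \<Longrightarrow> R n \<in> measurable M (borel_mat n k)"
  shows "prob_space (seq_law M I k R)"
  unfolding seq_law_def using assms(1) R
  by (intro prob_space.prob_space_distr measurable_restrict) auto

lemma summable_exp_uminus_powr:
  assumes "0 < (c :: real)"
  shows "summable (\<lambda>n. exp (- (real n powr c)))"
proof (rule summable_comparison_test_ev)
  have "\<forall>\<^sub>F n in sequentially. exp (- (real n powr c)) \<le> real n powr - 2"
    using assms by real_asymp
  then show "\<forall>\<^sub>F n in sequentially. norm (exp (- (real n powr c))) \<le> real n powr - 2"
    by simp
  show "summable (\<lambda>n. real n powr - 2)"
    by (simp add: summable_real_powr_iff)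
qed

text \<open>By the first Borel--Cantelli lemma, as \<open>exp (- (n powr c))\<close> is summable.\<close>

lemma seq_law_eventually:
  assumes M: "prob_space M" and R: "\<And>n. n \<in> I \<Longrightarrow> R n \<in> measurable M (borel_mat n k)"
    and E: "\<And>n. n \<in> I \<Longrightarrow> E n \<in> sets (borel_mat n k)"
    and prob: "\<And>n. n \<in> I \<Longrightarrow> 1 - C * exp (- (real n powr c)) \<le> measure (distr M (borel_mat n k) (R n)) (E n)"
    and c: "0 < c"
  shows "AE r in seq_law M I k R. \<forall>\<^sub>F n in sequentially. n \<in> I \<longrightarrow> r n \<in> E n"
proof -
  let ?L = "seq_law M I k R"
  interpret L: prob_space ?L
    by (rule prob_space_seq_law[OF M R])
  define A where "A n = (if n \<in> I then {r \<in> space ?L. r n \<notin> E n} else {})" for n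
  note comp = seq_law_component[where R = R and M = M and I = I and k = k, OF R]
  have pre: "{r \<in> space ?L. r n \<in> E n} \<in> sets ?L" if "n \<in> I" for n
    using measurable_sets[OF comp(1)[OF _ that] E[OF that]] by (simp add: vimage_def Int_def conj_commute)
  have A_eq: "A n = space ?L - {r \<in> space ?L. r n \<in> E n}" if "n \<in> I" for n
    using that by (auto simp: A_def)
  have A: "A n \<in> sets ?L" for n
  proof (cases "n \<in> I")
    case True
    then show ?thesis
      using pre[OF True] by (simp add: A_eq)
  qed (simp add: A_def)
  have bound: "measure ?L (A n) \<le> \<bar>C\<bar> * exp (- (real n powr c))" for n
  proof (cases "n \<in> I")
    case True
    have "measure (distr M (borel_mat n k) (R n)) (E n) = measure ?L ((\<lambda>r. r n) -` E n \<inter> space ?L)"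
      using measure_distr[OF comp(1)[OF _ True] E[OF True]] by (simp add: comp(2)[OF _ True])
    also have "(\<lambda>r. r n) -` E n \<inter> space ?L = {r \<in> space ?L. r n \<in> E n}"
      by auto
    finally have "measure ?L (A n) \<le> C * exp (- (real n powr c))"
      using prob[OF True] L.prob_compl[OF pre[OF True]] by (simp add: A_eq[OF True])
    also have "\<dots> \<le> \<bar>C\<bar> * exp (- (real n powr c))"
      by (intro mult_right_mono) auto
    finally show ?thesis .
  qed (simp add: A_def)
  have "summable (\<lambda>n. measure ?L (A n))"
  proof (rule summable_comparison_test')
    show "summable (\<lambda>n. \<bar>C\<bar> * exp (- (real n powr c)))"
      by (intro summable_mult summable_exp_uminus_powr c)
    show "norm (measure ?L (A n)) \<le> \<bar>C\<bar> * exp (- (real n powr c))" if "0 \<le> n" for n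
      using bound by simp
  qed
  then have "AE r in ?L. \<forall>\<^sub>F n in sequentially. r \<in> space ?L - A n"
    using A by (intro borel_cantelli_AE1) (auto simp: L.emeasure_eq_measure)
  then show ?thesis
  proof eventually_elim
    case (elim r)
    then show ?case
      by eventually_elim (auto simp: A_def)
  qed
qed

lemma tendsto_of_relative_error:
  fixes f :: "nat \<Rightarrow> real"
  assumes "0 < a" and c: "0 < c3" "0 < c4"
    and bound: "\<And>n. b \<le> real (n + N) powr c4 \<Longrightarrow> \<bar>f n / a - 1\<bar> \<le> C / real (n + N) powr c3"
  shows "f \<longlonglongrightarrow> a"
proof -
  have "filterlim (\<lambda>n. real (n + N) powr c4) at_top sequentially"
    using c by real_asymp
  then have ev: "\<forall>\<^sub>F n in sequentially. b \<le> real (n + N) powr c4"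
    by (simp add: filterlim_at_top)
  have "(\<lambda>n. f n / a - 1) \<longlonglongrightarrow> 0"
  proof (rule Lim_null_comparison)
    show "\<forall>\<^sub>F n in sequentially. norm (f n / a - 1) \<le> C / real (n + N) powr c3"
      using ev by eventually_elim (simp only: real_norm_def bound)
    show "(\<lambda>n. C / real (n + N) powr c3) \<longlonglongrightarrow> 0"
      using c by real_asymp
  qed
  then have "(\<lambda>n. (f n / a - 1) * a + a) \<longlonglongrightarrow> 0 * a + a"
    by (intro tendsto_intros)
  then show ?thesis
    using assms(1) by (simp add: field_simps)
qed

theorem mainTheorem4:
  fixes M :: "'w measure"
    and C c1 c2 c3 c4 :: real
    and m l :: nat and ls :: "nat \<Rightarrow> nat" and I :: "nat set"
    and Q W :: "real mat"
    and R :: "nat \<Rightarrow> 'w \<Rightarrow> real mat" and \<xi> :: "nat \<Rightarrow> 'w \<Rightarrow> real vec"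
    and \<gamma> :: "nat \<Rightarrow> real mat \<Rightarrow> nat \<Rightarrow> real vec \<Rightarrow> real"
    and \<gamma>hat :: "(nat \<Rightarrow> real mat) \<Rightarrow> nat \<Rightarrow> real vec \<Rightarrow> real"
    and \<gamma>G :: "nat \<Rightarrow> real vec \<Rightarrow> real"
  assumes "prob_space M"
    and "0 < C" "0 < c1" "0 < c2" "0 < c3" "0 < c4"
    and "eldan_klartag C c1 c2 c3 c4"
    and "l = m + (\<Sum>i<m. ls i)"
    and "I = {n. real l powr (1 / c1) \<le> real n}"
    and "sym_pos_def m Q"
    and "W \<in> carrier_mat l l"
    and "\<And>n. n \<in> I \<Longrightarrow> isotropic n M (\<xi> n)"
    and "\<And>n. n \<in> I \<Longrightarrow> has_log_concave_density n M (\<xi> n)"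
    and "\<And>n. n \<in> I \<Longrightarrow> R n \<in> measurable M (borel_mat n l)"
    and "\<And>n. n \<in> I \<Longrightarrow> uniform_stiefel n l (distr M (borel_mat n l) (R n))"
    and "prob_space.indep_vars M (\<lambda>n. borel_mat n l) R I"
    and "prob_space.indep_set M
           (sets (vimage_algebra (space M) (\<lambda>\<omega>. \<lambda>n\<in>I. R n \<omega>) (\<Pi>\<^sub>M n\<in>I. borel_mat n l)))
           (sets (vimage_algebra (space M) (\<lambda>\<omega>. \<lambda>n\<in>I. \<xi> n \<omega>) (\<Pi>\<^sub>M n\<in>I. lborel_vec n)))"
    and "\<And>n r i. n \<in> I \<Longrightarrow> r \<in> stiefel n l \<Longrightarrow> i < m \<Longrightarrow> full_row_rank (ens_H W m ls r i)"
    and "\<And>n r. n \<in> I \<Longrightarrow> r \<in> stiefel n l \<Longrightarrow>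
           team_solution Q (ens_S W m r) (ens_H W m ls r) M (\<xi> n) (\<gamma> n r)"
    and "team_solution Q (state_block W m) (obs_block W m ls) (gauss_vec l) (\<lambda>x. x) \<gamma>G"
    and "AE r in seq_law M I l R. \<forall>i<m. AE y in lborel_vec (ls i).
           (\<lambda>n. \<gamma> n (r n) i y) \<longlonglongrightarrow> \<gamma>hat r i y"
  shows "AE r in seq_law M I l R. \<forall>i<m. AE y in lborel_vec (ls i). \<gamma>hat r i y = \<gamma>G i y"
proof (cases "m = 0")
  case False
  note M = assms(1) and c_pos = assms(2-6) and ek = assms(7) and l = assms(8) and I = assms(9)
    and Q = assms(10) and W = assms(11) and iso = assms(12) and logc = assms(13) and R = assms(14)
    and unif = assms(15) and rank = assms(18) and sol = assms(19) and solG = assms(20)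
    and lim = assms(21)
  interpret M: prob_space M by (rule M)
  let ?S = "state_block W m" and ?H = "obs_block W m ls"
  let ?good = "\<lambda>n r. \<exists>f. (\<forall>x. 0 \<le> f x) \<and>
     distributed (distr M (lborel_vec n) (\<xi> n)) (lborel_vec l) (\<lambda>x. transpose_mat r *\<^sub>v x) (\<lambda>x. ennreal (f x)) \<and>
     (\<forall>x\<in>carrier_vec l. vnorm x \<le> real n powr c4 \<longrightarrow>
        \<bar>f x / std_normal_vec l x - 1\<bar> \<le> C / real n powr c3)"
  have "\<exists>E. E \<in> sets (borel_mat n l) \<and>
      1 - C * exp (- (real n powr c2)) \<le> measure (distr M (borel_mat n l) (R n)) E \<and> (\<forall>r\<in>E. ?good n r)"
    if n: "n \<in> I" for n
  proof -
    have "1 \<le> l"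
      using False l by simp
    moreover have "real l \<le> real n powr c1"
    proof -
      have "(real l powr (1 / c1)) powr c1 \<le> real n powr c1"
        using n c_pos by (intro powr_mono2) (auto simp: I)
      then show ?thesis
        using c_pos by (simp add: powr_powr)
    qed
    moreover have "\<xi> n \<in> measurable M (lborel_vec n)"
      using iso[OF n] by (auto simp: isotropic_def)
    ultimately show ?thesis
      using ek[unfolded eldan_klartag_def, rule_format, of l n "distr M (lborel_vec n) (\<xi> n)"
          "distr M (borel_mat n l) (R n)"]
        M.prob_space_distr isotropic_distr[OF iso[OF n]] has_log_concave_density_distr[OF logc[OF n]] unif[OF n]
      by auto
  qed
  then obtain E where E: "\<And>n. n \<in> I \<Longrightarrow> E n \<in> sets (borel_mat n l)"
    "\<And>n. n \<in> I \<Longrightarrow> 1 - C * exp (- (real n powr c2)) \<le> measure (distr M (borel_mat n l) (R n)) (E n)"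
    "\<And>n r. n \<in> I \<Longrightarrow> r \<in> E n \<Longrightarrow> ?good n r"
    by metis
  have "AE r in seq_law M I l R. r n \<in> stiefel n l" if n: "n \<in> I" for n
  proof (rule AE_distrD[OF seq_law_component(1)[OF R n]])
    show "AE r in distr (seq_law M I l R) (borel_mat n l) (\<lambda>r. r n). r \<in> stiefel n l"
    proof -
      have "distr (seq_law M I l R) (borel_mat n l) (\<lambda>r. r n) = distr M (borel_mat n l) (R n)"
        by (rule seq_law_component(2)[OF R n])
      then show ?thesis
        using unif[OF n] by (simp only: uniform_stiefel_def)
    qed
  qed
  then have "AE r in seq_law M I l R. \<forall>n\<in>I. r n \<in> stiefel n l"
    by (subst AE_ball_countable) auto
  moreover have "AE r in seq_law M I l R. \<forall>\<^sub>F n in sequentially. n \<in> I \<longrightarrow> r n \<in> E n"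
    by (rule seq_law_eventually[OF M R E(1,2) c_pos(3)])
  ultimately show ?thesis
    using lim
  proof eventually_elim
    case (elim r)
    then have st: "\<And>n. n \<in> I \<Longrightarrow> r n \<in> stiefel n l"
      and ev: "\<forall>\<^sub>F n in sequentially. n \<in> I \<longrightarrow> r n \<in> E n"
      and lim: "\<And>i. i < m \<Longrightarrow> AE y in lborel_vec (ls i). (\<lambda>n. \<gamma> n (r n) i y) \<longlonglongrightarrow> \<gamma>hat r i y"
      by auto
    \<comment> \<open>From \<open>N\<close> on, the projections are defined and lie in the good events; the sequences below are
      shifted by \<open>N\<close>.\<close>
    obtain K :: nat where K: "real l powr (1 / c1) \<le> real K"
      using real_arch_simple by blast
    obtain N0 where N0: "\<And>n. n \<ge> N0 \<Longrightarrow> n \<in> I \<Longrightarrow> r n \<in> E n"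
      using ev by (auto simp: eventually_sequentially)
    define N where "N = max K N0"
    have NI: "n + N \<in> I" and NE: "r (n + N) \<in> E (n + N)" for n
    proof -
      show "n + N \<in> I"
        using K by (auto simp: I N_def)
      then show "r (n + N) \<in> E (n + N)"
        by (intro N0) (auto simp: N_def)
    qed
    have rc: "r (n + N) \<in> carrier_mat (n + N) l" for n
      using st[OF NI] by (auto simp: stiefel_def)
    have S: "?S \<in> carrier_mat m l"
      using W by (auto simp: state_block_def row_block_def)
    have H: "?H i \<in> carrier_mat (ls i) l" for i
      using W by (auto simp: obs_block_def row_block_def)
    interpret team_problem Q ?S ?H m l ls
    proof
      fix i and z :: "real vec" assume i: "i < m" and z: "z \<in> carrier_vec (ls i)"
      have rt: "transpose_mat (r (0 + N)) \<in> carrier_mat l (0 + N)"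
        using rc[of 0] by auto
      have "ens_H W m ls (r (0 + N)) i \<in> carrier_mat (ls i) (0 + N)"
        unfolding ens_H_def by (rule mult_carrier_mat[OF H rt])
      then obtain x where x: "x \<in> carrier_vec (0 + N)" "ens_H W m ls (r (0 + N)) i *\<^sub>v x = z"
        using full_row_rank_surj[OF _ rank[OF NI st[OF NI] i] z] by blast
      then have "?H i *\<^sub>v (transpose_mat (r (0 + N)) *\<^sub>v x) = z"
        using assoc_mult_mat_vec[OF H rt x(1)] by (simp add: ens_H_def)
      moreover have "transpose_mat (r (0 + N)) *\<^sub>v x \<in> carrier_vec l"
        using rt x(1) by (rule mult_mat_vec_carrier)
      ultimately show "\<exists>x\<in>carrier_vec l. ?H i *\<^sub>v x = z"
        by blast
    qed (use Q S H in auto)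
    have "\<forall>n. \<exists>f. (\<forall>x. 0 \<le> f x) \<and>
       distributed (distr M (lborel_vec (n + N)) (\<xi> (n + N))) (lborel_vec l)
         (\<lambda>x. transpose_mat (r (n + N)) *\<^sub>v x) (\<lambda>x. ennreal (f x)) \<and>
       (\<forall>x\<in>carrier_vec l. vnorm x \<le> real (n + N) powr c4 \<longrightarrow>
          \<bar>f x / std_normal_vec l x - 1\<bar> \<le> C / real (n + N) powr c3)"
      using E(3)[OF NI NE] by blast
    then obtain f where f: "\<And>n x. 0 \<le> f n x"
      "\<And>n. distributed (distr M (lborel_vec (n + N)) (\<xi> (n + N))) (lborel_vec l)
         (\<lambda>x. transpose_mat (r (n + N)) *\<^sub>v x) (\<lambda>x. ennreal (f n x))"
      "\<And>n x. x \<in> carrier_vec l \<Longrightarrow> vnorm x \<le> real (n + N) powr c4 \<Longrightarrow>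
          \<bar>f n x / std_normal_vec l x - 1\<bar> \<le> C / real (n + N) powr c3"
      unfolding choice_iff by blast
    have f_meas: "f n \<in> borel_measurable (lborel_vec l)" for n
      using distributed_real_measurable[OF f(1) f(2)] by simp
    have adm_iff: "admissible Q (ens_H W m ls r') \<beta> \<longleftrightarrow> admissible Q ?H \<beta>" for r' \<beta>
      by (simp add: admissible_def ens_H_def)
    have cost: "team_cost Q (ens_S W m (r (n + N))) (ens_H W m ls (r (n + N))) M (\<xi> (n + N)) \<beta> = risk (f n) \<beta>"
      if "admissible Q ?H \<beta>" for n \<beta>
      unfolding ens_S_def ens_H_def[abs_def] team_risk_def
    proof (rule team_cost_observed[OF Q S H rc _ f(2) that])
      show "\<xi> (n + N) \<in> measurable M (lborel_vec (n + N))"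
        using iso[OF NI] by (simp add: isotropic_def)
    qed
    have gauss: "team_cost Q ?S ?H (gauss_vec l) (\<lambda>x. x) \<beta> = risk \<phi> \<beta>" if "admissible Q ?H \<beta>" for \<beta>
    proof -
      have "team_cost Q ?S ?H (gauss_vec l) (\<lambda>x. x) \<beta> = (\<integral>\<^sup>+ y. ennreal (loss \<beta> y) \<partial>gauss_vec l)"
        by (simp add: team_cost_def profile_loss_def)
      also have "\<dots> = risk \<phi> \<beta>"
        using borel_measurable_loss[OF that]
        by (simp add: gauss_vec_def team_risk_def nn_integral_density mult.commute)
      finally show ?thesis .
    qed
    show ?case
    proof (intro allI impI)
      fix i assume i: "i < m"
      show "AE y in lborel_vec (ls i). \<gamma>hat r i y = \<gamma>G i y"
      proof (rule limit_of_minimizers[where g = "\<lambda>n. \<gamma> (n + N) (r (n + N))" and f = f])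
        fix n
        have sol_n: "team_solution Q (ens_S W m (r (n + N))) (ens_H W m ls (r (n + N))) M (\<xi> (n + N))
            (\<gamma> (n + N) (r (n + N)))"
          by (rule sol[OF NI st[OF NI]])
        then show adm: "admissible Q ?H (\<gamma> (n + N) (r (n + N)))"
          by (simp add: team_solution_def adm_iff)
        show "risk (f n) (\<gamma> (n + N) (r (n + N))) \<le> risk (f n) \<beta>" if "admissible Q ?H \<beta>" for \<beta>
          using sol_n that by (simp add: team_solution_def adm_iff cost[OF adm, symmetric] cost[OF that, symmetric])
        show "f n \<in> borel_measurable (lborel_vec l)"
          by (rule f_meas)
        show "0 \<le> f n y" for y
          by (rule f(1))
        show "(\<integral>\<^sup>+ y. ennreal (f n y) \<partial>lborel_vec l) = 1"
          and "(\<integral>\<^sup>+ y. ennreal (sqnorm y) * ennreal (f n y) \<partial>lborel_vec l) = ennreal (real l)"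
          by (rule projected_density_moments[OF M iso[OF NI] st[OF NI] f(2)])+
      next
        fix y :: "real vec" assume y: "y \<in> carrier_vec l"
        show "(\<lambda>n. f n y) \<longlonglongrightarrow> \<phi> y"
          by (rule tendsto_of_relative_error[OF std_normal_vec_pos c_pos(4,5) f(3)[OF y]])
      next
        fix j assume "j < m"
        from lim[OF this]
        show "AE z in lborel_vec (ls j). (\<lambda>n. \<gamma> (n + N) (r (n + N)) j z) \<longlonglongrightarrow> \<gamma>hat r j z"
          by eventually_elim (rule LIMSEQ_ignore_initial_segment)
      next
        show admG: "admissible Q ?H \<gamma>G"
          using solG by (simp add: team_solution_def)
        show "risk \<phi> \<gamma>G \<le> risk \<phi> \<beta>" if "admissible Q ?H \<beta>" for \<beta>
          using solG that by (simp add: team_solution_def gauss[OF admG, symmetric] gauss[OF that, symmetric])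
      qed (rule i)
    qed
  qed
qed simp

end
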